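(* Let $x_t, y_t \in \mathbb{R}^n$ be fixed. For $W \in \mathbb{R}^{k\times n}$ let $x^*(W) = \arg\min_{x \in \mathbb{R}^n} \frac{1}{2}\|x-y_t\|_2^2 + \|Wx\|_1$, and let $U(W) = \frac12 \|x^*(W) - x_t\|_2^2$. Suppose that $\mathrm{sign}(W x^*(W))$ is constant on an open neighbourhood of $W$. Let $W_0$ and $W_{\pm}$ be the matrices consisting of the rows of $W$ with indices $i$ such that $(W x^*(W))_i = 0$ and $(W x^*(W))_i \neq 0$, respectively, let $s$ be the vector of nonzero entries of $\mathrm{sign}(W x^*(W))$, and let $P_{\mathcal{N}(W_0)} = I - W_0^{\dagger}W_0$. Put $q = y_t - W_{\pm}^{\mathsf{T}} s$ and $\nabla_{x^*} U = x^*(W) - x_t$. Then the gradients of $U$ with respect to $W_{\pm}$ and $W_0$ are $$\nabla_{W_{\pm}} U = - s\, (\nabla_{x^*} U)^{\mathsf{T}} P_{\mathcal{N}(W_0)},$$ $$\nabla_{W_0} U = - \Bigl( P_{\mathcal{N}(W_0)} \bigl( q\, (\nabla_{x^*} U)^{\mathsf{T}} + (\nabla_{x^*} U)\, q^{\mathsf{T}} \bigr) W_0^{\dagger} \Bigr)^{\mathsf{T}} .$$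
   Context: The objective $x \mapsto \frac12\|x-y_t\|_2^2+\|Wx\|_1$ is strictly convex and has a unique global minimizer, so $x^*(W)$ is well defined. The function $\mathrm{sign}$ acts entrywise, with $\mathrm{sign}(z)_i = -1$ if $z_i<0$, $0$ if $z_i = 0$, and $1$ if $z_i>0$. $W_0^{\dagger}$ denotes the Moore-Penrose pseudoinverse, and $P_{\mathcal{N}(W_0)}$ is the orthogonal projector onto the nullspace of $W_0$. The gradient of a scalar function with respect to a matrix $M$ is the matrix of the same shape as $M$ whose $(i,j)$ entry is the partial derivative with respect to $M_{ij}$. Since the sign vector is constant near $W$, the partition of row indices into those of $W_0$ and those of $W_{\pm}$ is constant near $W$, so $U$ can be regarded locally as a function of the pair $(W_0, W_{\pm})$. Rows are kept in the same order as in $W$. If $W_0$ has no rows, $P_{\mathcal{N}(W_0)} = I$ and the formula for $\nabla_{W_0}U$ is vacuous; if $W_{\pm}$ has no rows, $W_{\pm}^{\mathsf{T}} s = 0$ and the formula for $\nabla_{W_\pm}U$ is vacuous. *)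

theory Defs
  imports Complex_Main "Jordan_Normal_Form.DL_Submatrix"
begin

definition l1_norm :: "real vec \<Rightarrow> real" where
  "l1_norm v = (\<Sum>i<dim_vec v. \<bar>v $ i\<bar>)"

definition l2_norm :: "real vec \<Rightarrow> real" where
  "l2_norm v = sqrt (v \<bullet> v)"

definition outer_prod :: "real vec \<Rightarrow> real vec \<Rightarrow> real mat" where
  "outer_prod v w = mat (dim_vec v) (dim_vec w) (\<lambda>(i, j). v $ i * w $ j)"

definition zero_indices :: "real vec \<Rightarrow> nat set" where
  "zero_indices v = {i. i < dim_vec v \<and> v $ i = 0}"

definition nonzero_indices :: "real vec \<Rightarrow> nat set" where
  "nonzero_indices v = {i. i < dim_vec v \<and> v $ i \<noteq> 0}"

definition select_rows :: "real mat \<Rightarrow> nat set \<Rightarrow> real mat" where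
  "select_rows A I = submatrix A I UNIV"

definition nonzero_entries :: "real vec \<Rightarrow> real vec" where
  "nonzero_entries v = vec_of_list (filter (\<lambda>a. a \<noteq> 0) (list_of_vec v))"

text \<open>
  Inverse of splitting a matrix into the rows with index in \<open>I\<close> and the remaining rows,
  both kept in their original order: row \<open>i\<close> of the result is the row of \<open>A\<close> (for \<open>i \<in> I\<close>)
  or of \<open>B\<close> (for \<open>i \<notin> I\<close>) whose position is the rank of \<open>i\<close> within its class.
\<close>

definition merge_rows :: "nat set \<Rightarrow> real mat \<Rightarrow> real mat \<Rightarrow> real mat" where
  "merge_rows I A B = mat (dim_row A + dim_row B) (dim_col A)
     (\<lambda>(i, j). if i \<in> I then A $$ (card {a \<in> I. a < i}, j)
               else B $$ (card {a \<in> - I. a < i}, j))"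

lemma merge_select_rows:
  assumes "v \<in> carrier_vec (dim_row W)"
  shows "merge_rows (zero_indices v)
           (select_rows W (zero_indices v)) (select_rows W (nonzero_indices v)) = W"
proof -
  let ?Z = "zero_indices v" and ?N = "nonzero_indices v"
  have d: "dim_vec v = dim_row W" using assms by simp
  have Z: "{i. i < dim_row W \<and> i \<in> ?Z} = ?Z" and N: "{i. i < dim_row W \<and> i \<in> ?N} = ?N"
    by (auto simp: zero_indices_def nonzero_indices_def d)
  have "card ?Z + card ?N = card (?Z \<union> ?N)"
    by (rule card_Un_disjoint[symmetric]) (auto simp: zero_indices_def nonzero_indices_def)
  also have "?Z \<union> ?N = {..<dim_row W}"
    by (auto simp: zero_indices_def nonzero_indices_def d)
  finally have k: "card ?Z + card ?N = dim_row W" by simp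
  show ?thesis
  proof (rule eq_matI)
    fix i j assume i: "i < dim_row W" and j: "j < dim_col W"
    have UU: "{a \<in> (UNIV :: nat set). a < j} = {..<j}" by auto
    have sub: "select_rows W I $$ (card {a \<in> I. a < i}, j) = W $$ (i, j)" if "i \<in> I" for I
      using submatrix_index_card[OF i j that UNIV_I] by (simp add: select_rows_def UU)
    have compl: "{a. a \<notin> ?Z \<and> a < i} = {a \<in> ?N. a < i}"
      using i by (auto simp: zero_indices_def nonzero_indices_def d)
    have mem: "i \<in> ?N" if "i \<notin> ?Z"
      using i that by (auto simp: zero_indices_def nonzero_indices_def d)
    show "merge_rows ?Z (select_rows W ?Z) (select_rows W ?N) $$ (i, j) = W $$ (i, j)"
      using i j sub[of ?Z] sub[OF mem] k
      by (simp add: merge_rows_def)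
         (simp add: select_rows_def dim_submatrix Z N compl)
  qed (use k in \<open>simp_all add: merge_rows_def select_rows_def dim_submatrix Z N\<close>)
qed

definition is_pseudo_inverse :: "real mat \<Rightarrow> real mat \<Rightarrow> bool" where
  "is_pseudo_inverse A X \<longleftrightarrow>
     X \<in> carrier_mat (dim_col A) (dim_row A) \<and>
     A * X * A = A \<and> X * A * X = X \<and>
     transpose_mat (A * X) = A * X \<and> transpose_mat (X * A) = X * A"

definition pseudo_inverse :: "real mat \<Rightarrow> real mat" where
  "pseudo_inverse A = (THE X. is_pseudo_inverse A X)"

definition null_projector :: "real mat \<Rightarrow> real mat" where
  "null_projector A = 1\<^sub>m (dim_col A) - pseudo_inverse A * A"

text \<open>
  The library has no topology on \<open>real mat\<close>. The usual topology of the space of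
  \<open>k \<times> n\<close> matrices is the one induced by the maximum entry norm.
\<close>

definition open_mat_set :: "nat \<Rightarrow> nat \<Rightarrow> real mat set \<Rightarrow> bool" where
  "open_mat_set k n S \<longleftrightarrow> S \<subseteq> carrier_mat k n \<and>
     (\<forall>A\<in>S. \<exists>e>0. \<forall>B\<in>carrier_mat k n.
        (\<forall>i<k. \<forall>j<n. \<bar>B $$ (i, j) - A $$ (i, j)\<bar> < e) \<longrightarrow> B \<in> S)"

definition update_entry :: "real mat \<Rightarrow> nat \<times> nat \<Rightarrow> real \<Rightarrow> real mat" where
  "update_entry M p t =
     mat (dim_row M) (dim_col M) (\<lambda>ij. if ij = p then t else M $$ ij)"

definition has_mat_gradient :: "(real mat \<Rightarrow> real) \<Rightarrow> real mat \<Rightarrow> real mat \<Rightarrow> bool" where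
  "has_mat_gradient F G M \<longleftrightarrow> G \<in> carrier_mat (dim_row M) (dim_col M) \<and>
     (\<forall>i<dim_row M. \<forall>j<dim_col M.
        ((\<lambda>t. F (update_entry M (i, j) t)) has_real_derivative G $$ (i, j)) (at (M $$ (i, j))))"

definition objective :: "real vec \<Rightarrow> real mat \<Rightarrow> real vec \<Rightarrow> real" where
  "objective y W x = 1/2 * (l2_norm (x - y))\<^sup>2 + l1_norm (W *\<^sub>v x)"

definition minimizer :: "real vec \<Rightarrow> real mat \<Rightarrow> real vec" where
  "minimizer y W = arg_min_on (objective y W) (carrier_vec (dim_col W))"

definition loss :: "real vec \<Rightarrow> real vec \<Rightarrow> real mat \<Rightarrow> real" where
  "loss x\<^sub>t y W = 1/2 * (l2_norm (minimizer y W - x\<^sub>t))\<^sup>2"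

definition sign_vec :: "real vec \<Rightarrow> real mat \<Rightarrow> real vec" where
  "sign_vec y W = map_vec sgn (W *\<^sub>v minimizer y W)"

end

theory Submission
  imports Defs "HOL-Analysis.Function_Topology"
begin

text \<open>
  The optimality conditions give \<open>x = q - W\<^sub>0\<^sup>T z\<close>, \<open>W\<^sub>0 x = 0\<close> with \<open>z\<close> in the unit cube, and by
  sign constancy the same system, with perturbed matrices, governs the minimizer for all nearby
  \<open>W\<close>. Hence \<open>x = P q\<close>, which is affine in \<open>W\<^sub>\<plusminus>\<close>. Replacing \<open>W\<^sub>0\<close> by \<open>W\<^sub>0 + \<tau> d v\<^sup>T\<close> moves the
  solution from \<open>x\<close> to \<open>x'\<close> with the exact identity
  \<open>x' - x = - \<tau> ((v \<bullet> x') W\<^sub>0\<^sup>\<dagger> d + (d \<bullet> z') P v)\<close>, so the pseudoinverse is never differentiated; the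
  boundedness of \<open>x'\<close> and \<open>z'\<close> gives \<open>x' \<rightarrow> x\<close>.

  It remains to control \<open>z'\<close>. If the rows of \<open>W\<^sub>0\<close> are independent, then \<open>z'\<close> converges to
  \<open>W\<^sub>0\<^sup>\<dagger>\<^sup>T q\<close>; if the columns are, then \<open>P = 0\<close> and \<open>z'\<close> does not matter. If neither holds, then
  solvability of the system for all nearby matrices forces \<open>q = 0\<close>, and the solution vanishes
  identically.
\<close>

section \<open>Existence and uniqueness of the pseudoinverse\<close>

text \<open>
  The numbers refer to Penrose's equations. Appending a row \<open>a\<close> adds to the orthogonal projector
  \<open>G A\<close> onto the row space the projector onto the component \<open>d\<close> of \<open>a\<close> orthogonal to it; for
  \<open>d = 0\<close> the division by \<open>D = 0\<close> gives \<open>v = 0\<close>, as it should.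
\<close>

lemma ex_inverse14_fun:
  fixes A :: "nat \<Rightarrow> nat \<Rightarrow> real"
  shows "\<exists>G. (\<forall>i<n. \<forall>j<n. (\<Sum>l<k. G i l * A l j) = (\<Sum>l<k. G j l * A l i)) \<and>
    (\<forall>i<k. \<forall>m<n. (\<Sum>j<n. A i j * (\<Sum>l<k. G j l * A l m)) = A i m)"
proof (induction k)
  case 0
  then show ?case by simp
next
  case (Suc k)
  then obtain G where
    sym: "\<And>i j. i < n \<Longrightarrow> j < n \<Longrightarrow> (\<Sum>l<k. G i l * A l j) = (\<Sum>l<k. G j l * A l i)" and
    inv: "\<And>i m. i < k \<Longrightarrow> m < n \<Longrightarrow> (\<Sum>j<n. A i j * (\<Sum>l<k. G j l * A l m)) = A i m"
    by blast
  define Q where "Q i j = (\<Sum>l<k. G i l * A l j)" for i j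
  define d where "d j = A k j - (\<Sum>m<n. A k m * Q m j)" for j
  define D where "D = (\<Sum>j<n. d j * d j)"
  define v where "v j = d j / D" for j
  \<comment> \<open>Greville's recursion: the new last column is \<open>v\<close>, and the old
    columns lose \<open>v\<close> times row \<open>k\<close> of \<open>A\<close> times
    \<open>G\<close>, so that the product with \<open>A\<close> collapses to
    \<open>Q i j + v i * d j\<close>.\<close>
  define G' where "G' i l = (if l < k then G i l - v i * (\<Sum>m<n. A k m * G m l) else v i)" for i l
  have symQ: "Q i j = Q j i" if "i < n" "j < n" for i j
    unfolding Q_def using sym that by blast
  have AQ: "(\<Sum>j<n. A i j * Q j m) = A i m" if "i < k" "m < n" for i m
    unfolding Q_def using inv that by blast
  have "(\<Sum>l<Suc k. G' i l * A l j) = Q i j + v i * d j" for i j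
  proof -
    have "(\<Sum>l<Suc k. G' i l * A l j) =
        (\<Sum>l<k. G i l * A l j - v i * ((\<Sum>m<n. A k m * G m l) * A l j)) + v i * A k j"
      by (simp add: G'_def algebra_simps)
    also have "\<dots> = Q i j - v i * (\<Sum>l<k. (\<Sum>m<n. A k m * G m l) * A l j) + v i * A k j"
      by (simp add: Q_def sum_subtractf sum_distrib_left)
    also have "(\<Sum>l<k. (\<Sum>m<n. A k m * G m l) * A l j) = (\<Sum>l<k. \<Sum>m<n. A k m * G m l * A l j)"
      by (simp add: sum_distrib_right)
    also have "\<dots> = (\<Sum>m<n. A k m * Q m j)"
      unfolding Q_def by (subst sum.swap) (simp add: sum_distrib_left mult.assoc)
    finally show ?thesis by (simp add: d_def algebra_simps)
  qed
  note Q' = this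
  have Ad: "(\<Sum>j<n. A i j * d j) = 0" if i: "i < k" for i
  proof -
    have "(\<Sum>j<n. A i j * (\<Sum>m<n. A k m * Q m j)) = (\<Sum>j<n. \<Sum>m<n. A k m * (A i j * Q j m))"
      by (auto intro!: sum.cong simp: sum_distrib_left symQ algebra_simps)
    also have "\<dots> = (\<Sum>m<n. A k m * (\<Sum>j<n. A i j * Q j m))"
      by (subst sum.swap) (simp add: sum_distrib_left)
    also have "\<dots> = (\<Sum>m<n. A k m * A i m)" using AQ i by simp
    finally show ?thesis
      by (simp add: d_def algebra_simps sum_subtractf)
  qed
  have Qd: "(\<Sum>j<n. Q i j * d j) = 0" if "i < n" for i
  proof -
    have "(\<Sum>j<n. Q i j * d j) = (\<Sum>j<n. \<Sum>l<k. G i l * (A l j * d j))"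
      by (simp add: Q_def sum_distrib_right mult.assoc)
    also have "\<dots> = (\<Sum>l<k. G i l * (\<Sum>j<n. A l j * d j))"
      by (subst sum.swap) (simp add: sum_distrib_left)
    finally show ?thesis using Ad by simp
  qed
  have "(\<Sum>j<n. (\<Sum>m<n. A k m * Q m j) * d j) = (\<Sum>j<n. \<Sum>m<n. A k m * (Q m j * d j))"
    by (simp add: sum_distrib_right mult.assoc)
  also have "\<dots> = (\<Sum>m<n. A k m * (\<Sum>j<n. Q m j * d j))"
    by (subst sum.swap) (simp add: sum_distrib_left)
  also have "\<dots> = 0" using Qd by simp
  finally have "(\<Sum>j<n. A k j * d j) = D"
    unfolding D_def by (subst (2) d_def) (simp add: algebra_simps sum_subtractf)
  then have akv: "(\<Sum>j<n. A k j * v j) = D / D"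
    by (simp add: v_def flip: sum_divide_distrib)
  \<comment> \<open>For \<open>D = 0\<close> the quotient \<open>D / D\<close> is 0 instead of 1,
    but then \<open>d\<close> vanishes as well, so \<open>D / D * d m = d m\<close> holds in both
    cases.\<close>
  have d0: "d j = 0" if "D = 0" "j < n" for j
    using that sum_nonneg_eq_0_iff[of "{..<n}" "\<lambda>j. d j * d j"] by (simp add: D_def)
  have "(\<Sum>j<n. A i j * (Q j m + v j * d m)) = A i m" if i: "i < Suc k" and m: "m < n" for i m
  proof -
    have "(\<Sum>j<n. A i j * (Q j m + v j * d m)) = (\<Sum>j<n. A i j * Q j m) + (\<Sum>j<n. A i j * v j) * d m"
      by (simp add: sum.distrib algebra_simps sum_distrib_left)
    moreover have "(\<Sum>j<n. A i j * v j) = 0" if "i < k"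
      using Ad[OF that] by (simp add: v_def flip: sum_divide_distrib)
    moreover have "D / D * d m = d m" using d0[OF _ m] by (cases "D = 0") auto
    ultimately show ?thesis using AQ[OF _ m] akv i
      by (cases "i = k") (auto simp: d_def)
  qed
  moreover have "Q i j + v i * d j = Q j i + v j * d i" if "i < n" "j < n" for i j
    using symQ[OF that] by (simp add: v_def)
  ultimately show ?case
    unfolding Q'[symmetric] by (intro exI[of _ G'] conjI allI impI)
qed

text \<open>Reads the dimensions off the matrices themselves, so that the simplifier can reassociate
  products without being told the carriers.\<close>

lemma assoc_mult_mat_dim:
  fixes A B C :: "'a :: comm_semiring_0 mat"
  assumes "dim_col A = dim_row B" "dim_col B = dim_row C"
  shows "(A * B) * C = A * (B * C)"
  by (rule assoc_mult_mat[of A "dim_row A" "dim_row B" B "dim_row C" C "dim_col C"])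
    (use assms in \<open>auto intro: carrier_matI\<close>)

lemma ex_inverse14:
  assumes A: "(A :: real mat) \<in> carrier_mat k n"
  shows "\<exists>G \<in> carrier_mat n k. A * G * A = A \<and> transpose_mat (G * A) = G * A"
proof -
  obtain G where G:
    "\<forall>i<n. \<forall>j<n. (\<Sum>l<k. G i l * A $$ (l, j)) = (\<Sum>l<k. G j l * A $$ (l, i))"
    "\<forall>i<k. \<forall>m<n. (\<Sum>j<n. A $$ (i, j) * (\<Sum>l<k. G j l * A $$ (l, m))) = A $$ (i, m)"
    using ex_inverse14_fun[where A = "\<lambda>i j. A $$ (i, j)" and n = n and k = k]
    by (elim exE conjE) (rule that)
  note sym = G(1)[rule_format] and inv = G(2)[rule_format]
  define M where "M = mat n k (\<lambda>(i, l). G i l)"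
  have M: "M \<in> carrier_mat n k" by (simp add: M_def)
  have MA: "(M * A) $$ (i, j) = (\<Sum>l<k. G i l * A $$ (l, j))" if "i < n" "j < n" for i j
    using A that by (simp add: M_def scalar_prod_def atLeast0LessThan)
  have "transpose_mat (M * A) = M * A"
    using A M sym by (intro eq_matI) (simp_all del: index_mult_mat(1) add: MA)
  moreover have "A * (M * A) = A"
  proof (rule eq_matI)
    fix i m assume "i < dim_row A" "m < dim_col A"
    then have i: "i < k" "m < n" using A by auto
    have "(A * (M * A)) $$ (i, m) = (\<Sum>j<n. A $$ (i, j) * (M * A) $$ (j, m))"
      using A M i by (simp add: scalar_prod_def atLeast0LessThan)
    also have "\<dots> = A $$ (i, m)" using inv i by (simp add: MA)
    finally show "(A * (M * A)) $$ (i, m) = A $$ (i, m)" .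
  qed (use A M in auto)
  ultimately show ?thesis using M A assoc_mult_mat[OF A M A] by auto
qed

text \<open>Take \<open>G\<close> with equations 1 and 4 for \<open>A\<close>, and let
  \<open>H\<close> be the transpose of such an inverse of the transpose of \<open>A\<close>;
  transposition turns equation 4 into 3. Then \<open>X = G * A * H\<close> has
  \<open>A * X = A * H\<close> and \<open>X * A = G * A\<close>, hence all four properties.\<close>

lemma is_pseudo_inverse_exists: "\<exists>X. is_pseudo_inverse A X"
proof -
  define k n where "k = dim_row A" and "n = dim_col A"
  have A: "A \<in> carrier_mat k n" by (simp add: k_def n_def)
  obtain G where G: "G \<in> carrier_mat n k" "A * G * A = A" "transpose_mat (G * A) = G * A"
    using ex_inverse14[OF A] by blast
  obtain K where K: "K \<in> carrier_mat k n" "transpose_mat A * K * transpose_mat A = transpose_mat A"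
      "transpose_mat (K * transpose_mat A) = K * transpose_mat A"
    using ex_inverse14[of "transpose_mat A" n k] A by auto
  define H where "H = transpose_mat K"
  have H: "H \<in> carrier_mat n k" using K by (simp add: H_def)
  have "transpose_mat (transpose_mat A * K * transpose_mat A) = A * (H * A)"
    using A K(1) by (simp add: transpose_mult[of _ n k _ k] transpose_mult[of _ k n _ k] H_def assoc_mult_mat_dim)
  then have AHA: "A * (H * A) = A" using K(2) by simp
  have "transpose_mat (K * transpose_mat A) = A * H"
    using A K(1) by (simp add: transpose_mult[of _ k n _ k] H_def)
  moreover have "transpose_mat (A * H) = K * transpose_mat A"
    using A K(1) by (simp add: transpose_mult[of _ k n _ k] H_def)
  ultimately have AH: "transpose_mat (A * H) = A * H" using K(3) by simp
  have AGA: "A * (G * A) = A" using G A by simp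
  note c = A G(1) H
  have AGA': "A * (G * (A * Y)) = A * Y" if "Y \<in> carrier_mat n m" for Y m
  proof -
    have "A * (G * (A * Y)) = A * (G * A) * Y"
      using c that by (simp add: assoc_mult_mat[of _ k n _ n] assoc_mult_mat[of _ k n _ k]
          assoc_mult_mat[of _ n k _ n])
    then show ?thesis using AGA by simp
  qed
  define X where "X = G * A * H"
  have X: "X \<in> carrier_mat n k" using c by (simp add: X_def)
  have AX: "A * X = A * H"
    using c AGA'[OF H] by (simp add: X_def assoc_mult_mat[of _ n k _ n])
  have XA: "X * A = G * A"
    using c AHA by (simp add: X_def assoc_mult_mat[of _ n k _ n] assoc_mult_mat[of _ k n _ k]
          assoc_mult_mat[of _ n n _ k] assoc_mult_mat[of _ n k _ k])
  have "A * X * A = A"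
    using c AHA AX by (simp add: assoc_mult_mat[of _ k n _ k])
  moreover have "X * A * X = X"
    unfolding XA using c AGA'[OF H] by (simp add: X_def assoc_mult_mat_dim)
  ultimately show ?thesis
    unfolding is_pseudo_inverse_def using A X AX XA AH G(3) by auto
qed

text \<open>Symmetry lets the factors of \<open>(A * Y) * (A * X)\<close> be swapped under a
  transpose, which gives \<open>A * X = A * Y\<close>; likewise \<open>X * A = Y * A\<close>. Then
  \<open>X = X * A * X = X * A * Y = Y * A * Y = Y\<close>.\<close>

lemma is_pseudo_inverse_unique:
  assumes "is_pseudo_inverse A X" "is_pseudo_inverse A Y"
  shows "X = Y"
proof -
  define k n where "k = dim_row A" and "n = dim_col A"
  have A: "A \<in> carrier_mat k n" by (simp add: k_def n_def)
  have X: "X \<in> carrier_mat n k" "A * X * A = A" "X * A * X = X"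
      "transpose_mat (A * X) = A * X" "transpose_mat (X * A) = X * A"
    using assms(1) by (auto simp: is_pseudo_inverse_def k_def n_def)
  have Y: "Y \<in> carrier_mat n k" "A * Y * A = A" "Y * A * Y = Y"
      "transpose_mat (A * Y) = A * Y" "transpose_mat (Y * A) = Y * A"
    using assms(2) by (auto simp: is_pseudo_inverse_def k_def n_def)
  have "A * X = (A * Y * A) * X" by (simp only: Y(2))
  also have "\<dots> = (A * Y) * (A * X)"
    using A X(1) Y(1) by (simp add: assoc_mult_mat_dim)
  also have "\<dots> = transpose_mat (A * Y) * transpose_mat (A * X)"
    using X(4) Y(4) by simp
  also have "\<dots> = transpose_mat ((A * X) * (A * Y))"
    using transpose_mult[of "A * X" k k "A * Y" k] A X(1) Y(1) by simp
  also have "(A * X) * (A * Y) = (A * X * A) * Y"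
    using A X(1) Y(1) by (simp add: assoc_mult_mat_dim)
  also have "\<dots> = A * Y" by (simp only: X(2))
  finally have 1: "A * X = A * Y" using Y(4) by simp
  have "X * A = X * (A * Y * A)" by (simp only: Y(2))
  also have "\<dots> = (X * A) * (Y * A)"
    using A X(1) Y(1) by (simp add: assoc_mult_mat_dim)
  also have "\<dots> = transpose_mat (X * A) * transpose_mat (Y * A)"
    using X(5) Y(5) by simp
  also have "\<dots> = transpose_mat ((Y * A) * (X * A))"
    using transpose_mult[of "Y * A" n n "X * A" n] A X(1) Y(1) by simp
  also have "(Y * A) * (X * A) = Y * (A * X * A)"
    using A X(1) Y(1) by (simp add: assoc_mult_mat_dim)
  also have "\<dots> = Y * A" by (simp only: X(2))
  finally have 2: "X * A = Y * A" using Y(5) by simp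
  have "X = X * (A * X)" using A X(1,3) by simp
  also have "\<dots> = X * A * Y" using 1 A X(1) Y(1) by simp
  also have "\<dots> = Y" using 2 Y(3) by simp
  finally show ?thesis .
qed

lemma pseudo_inverse: "is_pseudo_inverse A (pseudo_inverse A)"
  unfolding pseudo_inverse_def
  using is_pseudo_inverse_exists[of A] is_pseudo_inverse_unique[of A] by (elim exE) (rule theI, auto)

section \<open>Optimality conditions\<close>

text \<open>Tychonoff: the cube is compact in the product topology, whatever the index type. Vectors
  of length \<open>k\<close> can thus be replaced by functions on all naturals.\<close>

lemma compact_box_attains_inf:
  fixes f :: "('i \<Rightarrow> real) \<Rightarrow> real"
  assumes "continuous_on UNIV f"
  shows "\<exists>z. (\<forall>i. \<bar>z i\<bar> \<le> 1) \<and> (\<forall>w. (\<forall>i. \<bar>w i\<bar> \<le> 1) \<longrightarrow> f z \<le> f w)"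
proof -
  define B where "B = PiE (UNIV :: 'i set) (\<lambda>_. {-1..1 :: real})"
  have B: "w \<in> B \<longleftrightarrow> (\<forall>i. \<bar>w i\<bar> \<le> 1)" for w
    by (auto simp: B_def PiE_UNIV_domain abs_le_iff minus_le_iff)
  have "compactin (product_topology (\<lambda>_ :: 'i. euclidean :: real topology) UNIV) B"
    unfolding B_def compactin_PiE by simp
  then have "compact B" by (simp add: euclidean_product_topology)
  moreover have "B \<noteq> {}" using B[of "\<lambda>_. 0"] by auto
  moreover have "continuous_on B f" using assms continuous_on_subset by blast
  ultimately obtain z where "z \<in> B" "\<forall>w\<in>B. f z \<le> f w"
    using continuous_attains_inf by blast
  then show ?thesis using B by blast
qed

text \<open>The vector \<open>z\<close> solves the dual problem, a least squares problem on the unit cube.\<close>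

lemma ex_dual_certificate_fun:
  fixes A :: "nat \<Rightarrow> nat \<Rightarrow> real" and y :: "nat \<Rightarrow> real"
  shows "\<exists>z. (\<forall>i. \<bar>z i\<bar> \<le> 1) \<and>
    (\<forall>i<k. z i * (\<Sum>j<n. A i j * (y j - (\<Sum>l<k. A l j * z l))) =
      \<bar>\<Sum>j<n. A i j * (y j - (\<Sum>l<k. A l j * z l))\<bar>)"
proof -
  define r where "r z j = y j - (\<Sum>l<k. A l j * z l)" for z :: "nat \<Rightarrow> real" and j
  define f where "f z = (\<Sum>j<n. (r z j)\<^sup>2)" for z
  have "continuous_on UNIV f"
    unfolding f_def r_def by (intro continuous_intros) auto
  from compact_box_attains_inf[OF this]
  obtain z where *: "\<forall>i. \<bar>z i\<bar> \<le> 1" "\<forall>w. (\<forall>i. \<bar>w i\<bar> \<le> 1) \<longrightarrow> f z \<le> f w"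
    by (elim exE conjE) (rule that)
  have z: "\<bar>z i\<bar> \<le> 1" for i using *(1) by blast
  have min: "f z \<le> f w" if "\<And>i. \<bar>w i\<bar> \<le> 1" for w
    using *(2)[THEN spec, of w, THEN mp] that by simp
  have "z i * (\<Sum>j<n. A i j * r z j) = \<bar>\<Sum>j<n. A i j * r z j\<bar>" if i: "i < k" for i
  proof -
    define c where "c = (\<Sum>j<n. A i j * r z j)"
    define a where "a = (\<Sum>j<n. (A i j)\<^sup>2)"
    \<comment> \<open>As \<open>sgn c * c = \<bar>c\<bar>\<close> and
      \<open>z i * c \<le> \<bar>c\<bar>\<close>, the claim \<open>z i * c = \<bar>c\<bar>\<close>
      amounts to \<open>m \<le> 0\<close>. The numbers \<open>m\<close> and \<open>M\<close> measure
      the linear gain and the quadratic loss when \<open>z i\<close> moves towards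
      \<open>sgn c\<close>.\<close>
    define m where "m = (sgn c - z i) * c"
    define M where "M = (sgn c - z i)\<^sup>2 * a"
    have "M \<ge> 0" by (simp add: M_def a_def sum_nonneg)
    have step: "2 * \<delta> * c \<le> \<delta>\<^sup>2 * a" if "\<bar>z i + \<delta>\<bar> \<le> 1" for \<delta>
    proof -
      let ?w = "z(i := z i + \<delta>)"
      have "(\<Sum>l<k. A l j * ?w l) = (\<Sum>l<k. A l j * z l) + \<delta> * A i j" for j
      proof -
        have "(\<Sum>l<k. A l j * ?w l) = (\<Sum>l<k. A l j * z l + (if l = i then \<delta> * A i j else 0))"
          by (rule sum.cong) (auto simp: algebra_simps)
        then show ?thesis using i by (simp add: sum.distrib)
      qed
      then have "f ?w = (\<Sum>j<n. (r z j - \<delta> * A i j)\<^sup>2)"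
        by (simp add: f_def r_def algebra_simps del: fun_upd_apply)
      also have "\<dots> = (\<Sum>j<n. (r z j)\<^sup>2 - 2 * \<delta> * (A i j * r z j) + \<delta>\<^sup>2 * (A i j)\<^sup>2)"
        by (intro sum.cong refl) (simp add: power2_eq_square algebra_simps)
      also have "\<dots> = f z - 2 * \<delta> * c + \<delta>\<^sup>2 * a"
        unfolding f_def c_def a_def sum.distrib sum_subtractf sum_distrib_left by simp
      finally show ?thesis using min[of ?w] z that by simp
    qed
    have "m \<le> 0"
    proof (rule ccontr)
      assume "\<not> m \<le> 0"
      then have m: "m > 0" by simp
      \<comment> \<open>A fraction \<open>\<theta>\<close> of the way to \<open>sgn c\<close> stays
        in the cube by convexity. This choice gives \<open>\<theta> * M \<le> m < 2 * m\<close>, so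
        the move would lower \<open>f\<close>; the \<open>+ 1\<close> covers
        \<open>M = 0\<close>.\<close>
      define \<theta> where "\<theta> = min 1 (m / (M + 1))"
      have \<theta>: "0 < \<theta>" "\<theta> \<le> 1" using m \<open>M \<ge> 0\<close> by (auto simp: \<theta>_def)
      have "\<bar>z i + \<theta> * (sgn c - z i)\<bar> = \<bar>(1 - \<theta>) * z i + \<theta> * sgn c\<bar>" by (simp add: algebra_simps)
      also have "\<dots> \<le> (1 - \<theta>) * \<bar>z i\<bar> + \<theta> * \<bar>sgn c\<bar>"
        using \<theta> by (intro order.trans[OF abs_triangle_ineq]) (simp add: abs_mult)
      also have "\<dots> \<le> (1 - \<theta>) * 1 + \<theta> * 1"
        using \<theta> z[of i] by (intro add_mono mult_left_mono) (auto simp: sgn_if)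
      finally have "\<bar>z i + \<theta> * (sgn c - z i)\<bar> \<le> 1" by simp
      from step[OF this] have "\<theta> * (2 * m) \<le> \<theta> * (\<theta> * M)"
        by (simp add: m_def M_def power2_eq_square algebra_simps)
      then have "2 * m \<le> \<theta> * M" using \<theta> by simp
      also have "\<dots> \<le> (m / (M + 1)) * M"
        using \<open>M \<ge> 0\<close> by (intro mult_right_mono) (simp_all add: \<theta>_def)
      also have "\<dots> \<le> m" using \<open>M \<ge> 0\<close> m by (simp add: field_simps)
      finally show False using m by simp
    qed
    moreover have "sgn c * c = \<bar>c\<bar>" by (simp add: sgn_if)
    moreover have "z i * c \<le> \<bar>c\<bar>"
      using z[of i] mult_right_mono[of "\<bar>z i\<bar>" 1 "\<bar>c\<bar>"] abs_ge_self[of "z i * c"]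
      by (simp add: abs_mult)
    ultimately show ?thesis by (simp add: m_def c_def algebra_simps)
  qed
  then show ?thesis using z unfolding r_def by blast
qed

text \<open>The primal point \<open>x\<close> is the residual of the dual least squares
  problem.\<close>

lemma ex_dual_certificate:
  fixes A :: "real mat"
  assumes A: "A \<in> carrier_mat k n" and y: "y \<in> carrier_vec n"
  shows "\<exists>x z. x \<in> carrier_vec n \<and> z \<in> carrier_vec k \<and> y = x + transpose_mat A *\<^sub>v z \<and>
    (\<forall>i<k. \<bar>z $ i\<bar> \<le> 1) \<and> (\<forall>i<k. z $ i * (A *\<^sub>v x) $ i = \<bar>(A *\<^sub>v x) $ i\<bar>)"
proof -
  obtain z :: "nat \<Rightarrow> real" where z: "\<forall>i. \<bar>z i\<bar> \<le> 1"
    "\<forall>i<k. z i * (\<Sum>j<n. A $$ (i, j) * (y $ j - (\<Sum>l<k. A $$ (l, j) * z l))) =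
      \<bar>\<Sum>j<n. A $$ (i, j) * (y $ j - (\<Sum>l<k. A $$ (l, j) * z l))\<bar>"
    using ex_dual_certificate_fun[where k = k and n = n and A = "\<lambda>i j. A $$ (i, j)" and y = "\<lambda>j. y $ j"]
    by (elim exE conjE) (rule that)
  define v where "v = vec k z"
  define x where "x = y - transpose_mat A *\<^sub>v v"
  have v: "v \<in> carrier_vec k" by (simp add: v_def)
  have x: "x \<in> carrier_vec n" using A y v by (simp add: x_def)
  have "y = x + transpose_mat A *\<^sub>v v" using A y by (intro eq_vecI) (auto simp: x_def)
  moreover have "(A *\<^sub>v x) $ i = (\<Sum>j<n. A $$ (i, j) * (y $ j - (\<Sum>l<k. A $$ (l, j) * z l)))"
    if "i < k" for i
    using A y that by (simp add: x_def v_def scalar_prod_def atLeast0LessThan)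
  moreover have "v $ i = z i" if "i < k" for i using that by (simp add: v_def)
  ultimately show ?thesis
    using x v z by (intro exI[of _ x] exI[of _ v] conjI allI impI) simp_all
qed

section \<open>Sufficiency of the optimality conditions and uniqueness of the minimizer\<close>

lemma l2_norm_square: "(l2_norm v)\<^sup>2 = v \<bullet> v"
  by (simp add: l2_norm_def scalar_prod_def sum_nonneg)

lemma scalar_prod_minus_self:
  fixes v w :: "real vec"
  assumes "v \<in> carrier_vec n" "w \<in> carrier_vec n"
  shows "(v - w) \<bullet> (v - w) = v \<bullet> v - 2 * (v \<bullet> w) + w \<bullet> w"
  using assms by (simp add: minus_scalar_prod_distrib[of _ n] scalar_prod_minus_distrib[of _ n]
      comm_scalar_prod[of w n v])

lemma scalar_prod_self_nonneg: "(v :: real vec) \<bullet> v \<ge> 0"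
  by (simp add: scalar_prod_def sum_nonneg)

lemma scalar_prod_self_eq_0:
  assumes "(v :: real vec) \<in> carrier_vec n"
  shows "v \<bullet> v = 0 \<longleftrightarrow> v = 0\<^sub>v n"
proof
  assume "v \<bullet> v = 0"
  then have "\<forall>i\<in>{0..<dim_vec v}. v $ i * v $ i = 0"
    by (subst (asm) scalar_prod_def) (simp add: sum_nonneg_eq_0_iff)
  then show "v = 0\<^sub>v n" using assms by (intro eq_vecI) auto
qed simp

text \<open>The vector \<open>z\<close> is a subgradient of the norm at \<open>A x\<close>, and the
  quadratic term adds a gap of half the squared distance to \<open>x\<close>. The gap gives
  minimality and uniqueness together; uniqueness is what determines the value of the choice operator
  behind \<open>minimizer\<close>.\<close>

lemma minimizer_eqI:
  assumes A: "A \<in> carrier_mat k n" and x: "x \<in> carrier_vec n" and z: "z \<in> carrier_vec k"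
    and y: "y = x + transpose_mat A *\<^sub>v z"
    and bound: "\<And>i. i < k \<Longrightarrow> \<bar>z $ i\<bar> \<le> 1"
    and compl: "\<And>i. i < k \<Longrightarrow> z $ i * (A *\<^sub>v x) $ i = \<bar>(A *\<^sub>v x) $ i\<bar>"
  shows "minimizer y A = x"
proof -
  let ?r = "transpose_mat A *\<^sub>v z"
  have r: "?r \<in> carrier_vec n" using A z by simp
  have xy: "x - y = 0\<^sub>v n - ?r" using x r unfolding y by (intro eq_vecI) auto
  have l1: "l1_norm (A *\<^sub>v w) = (\<Sum>i<k. \<bar>(A *\<^sub>v w) $ i\<bar>)" for w
    using A by (simp add: l1_norm_def)
  have pair: "w \<bullet> ?r = (\<Sum>i<k. z $ i * (A *\<^sub>v w) $ i)" if "w \<in> carrier_vec n" for w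
  proof -
    have "w \<bullet> ?r = z \<bullet> (A *\<^sub>v w)"
      using comm_scalar_prod[OF that r] transpose_vec_mult_scalar[OF A that z] by simp
    then show ?thesis using A by (simp add: scalar_prod_def atLeast0LessThan)
  qed
  have key: "objective y A x + 1/2 * ((w - x) \<bullet> (w - x)) \<le> objective y A w"
    if w: "w \<in> carrier_vec n" for w
  proof -
    have wy: "w - y = (w - x) - ?r"
      using A x r w unfolding y by (intro eq_vecI) (auto simp: carrier_vecD)
    have "(w - y) \<bullet> (w - y) = (w - x) \<bullet> (w - x) - 2 * ((w - x) \<bullet> ?r) + ?r \<bullet> ?r"
      unfolding wy using x r w by (intro scalar_prod_minus_self[of _ n]) auto
    moreover have "(x - y) \<bullet> (x - y) = ?r \<bullet> ?r"
      unfolding xy using r by (subst scalar_prod_minus_self[of _ n]) auto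
    moreover have "(w - x) \<bullet> ?r = w \<bullet> ?r - x \<bullet> ?r"
      using minus_scalar_prod_distrib[OF w x r] .
    moreover have "x \<bullet> ?r = l1_norm (A *\<^sub>v x)"
      unfolding pair[OF x] l1 using compl by simp
    moreover have "w \<bullet> ?r \<le> l1_norm (A *\<^sub>v w)"
      unfolding pair[OF w] l1
    proof (rule sum_mono)
      fix i assume "i \<in> {..<k}"
      then show "z $ i * (A *\<^sub>v w) $ i \<le> \<bar>(A *\<^sub>v w) $ i\<bar>"
        using bound[of i] mult_right_mono[of "\<bar>z $ i\<bar>" 1 "\<bar>(A *\<^sub>v w) $ i\<bar>"]
          abs_ge_self[of "z $ i * (A *\<^sub>v w) $ i"]
        by (simp add: abs_mult)
    qed
    ultimately show ?thesis unfolding objective_def l2_norm_square by linarith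
  qed
  have "is_arg_min (objective y A) (\<lambda>w. w \<in> carrier_vec n) w \<longleftrightarrow> w = x" for w
  proof
    assume "is_arg_min (objective y A) (\<lambda>w. w \<in> carrier_vec n) w"
    then have w: "w \<in> carrier_vec n" and "objective y A w \<le> objective y A x"
      using x by (auto simp: is_arg_min_def not_less)
    then have "(w - x) \<bullet> (w - x) = 0"
      using key[OF w] scalar_prod_self_nonneg[of "w - x"] by simp
    then have "w - x = 0\<^sub>v n" using scalar_prod_self_eq_0[of "w - x" n] w x by simp
    then have "(w - x) $ i = 0" if "i < n" for i using that by simp
    then show "w = x" using w x by (intro eq_vecI) auto
  next
    assume "w = x"
    then show "is_arg_min (objective y A) (\<lambda>w. w \<in> carrier_vec n) w"
      using x by (auto simp: is_arg_min_def not_less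
          intro: order.trans[OF _ key] simp: scalar_prod_self_nonneg)
  qed
  then show ?thesis using A by (simp add: minimizer_def arg_min_on_def arg_min_def)
qed

text \<open>Necessity without subdifferential calculus: the dual problem supplies a certified point,
  and by uniqueness that point is the minimizer.\<close>

lemma minimizer_kkt:
  assumes A: "A \<in> carrier_mat k n" and y: "y \<in> carrier_vec n"
  obtains z where "minimizer y A \<in> carrier_vec n" "z \<in> carrier_vec k"
    "y = minimizer y A + transpose_mat A *\<^sub>v z" "\<And>i. i < k \<Longrightarrow> \<bar>z $ i\<bar> \<le> 1"
    "\<And>i. i < k \<Longrightarrow> z $ i * (A *\<^sub>v minimizer y A) $ i = \<bar>(A *\<^sub>v minimizer y A) $ i\<bar>"
proof -
  obtain x z where *: "x \<in> carrier_vec n" "z \<in> carrier_vec k" "y = x + transpose_mat A *\<^sub>v z"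
    "\<forall>i<k. \<bar>z $ i\<bar> \<le> 1" "\<forall>i<k. z $ i * (A *\<^sub>v x) $ i = \<bar>(A *\<^sub>v x) $ i\<bar>"
    using ex_dual_certificate[OF A y] by (elim exE conjE) (rule that)
  then have "minimizer y A = x" by (intro minimizer_eqI[OF A, of x z y]) auto
  then show thesis using * by (intro that[of z]) auto
qed

section \<open>Splitting and merging rows\<close>

text \<open>The inverse of \<open>pick\<close> is the rank within \<open>I\<close>. Sums over
  selected rows become sums over their original indices.\<close>

lemma bij_betw_pick:
  assumes "finite I"
  shows "bij_betw (pick I) {..<card I} I"
proof (rule bij_betw_byWitness[where f' = "\<lambda>i. card {a \<in> I. a < i}"])
  show "\<forall>r\<in>{..<card I}. card {a \<in> I. a < pick I r} = r"
    by (simp add: card_pick)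
  show "\<forall>i\<in>I. pick I (card {a \<in> I. a < i}) = i"
    by (simp add: pick_card_in_set)
  show "pick I ` {..<card I} \<subseteq> I"
    by (auto simp: pick_in_set)
  show "(\<lambda>i. card {a \<in> I. a < i}) ` I \<subseteq> {..<card I}"
    using assms by (auto intro!: psubset_card_mono)
qed

context
  fixes k :: nat and v :: "real vec" and I J :: "nat set"
  assumes v: "v \<in> carrier_vec k" and I: "I = zero_indices v" and J: "J = nonzero_indices v"
begin

lemma index_sets: "finite I" "finite J" "I \<inter> J = {}" "I \<union> J = {..<k}"
  using v by (auto simp: I J zero_indices_def nonzero_indices_def)

lemma card_index_sets: "card I + card J = k"
  using card_Un_disjoint[OF index_sets(1-3)] index_sets(4) by simp

lemma select_rows_carrier:
  assumes "A \<in> carrier_mat k n" "K = I \<or> K = J"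
  shows "select_rows A K \<in> carrier_mat (card K) n"
proof -
  have "{i. i < dim_row A \<and> i \<in> K} = K" using assms index_sets by auto
  moreover have "{j. j < dim_col A \<and> j \<in> UNIV} = {..<n}" using assms(1) by auto
  ultimately show ?thesis
    by (intro carrier_matI) (simp_all only: select_rows_def dim_submatrix card_lessThan)
qed

lemma select_rows_index:
  assumes "A \<in> carrier_mat k n" "K = I \<or> K = J" "r < card K" "j < n"
  shows "select_rows A K $$ (r, j) = A $$ (pick K r, j)"
proof -
  have "{i. i < dim_row A \<and> i \<in> K} = K" using assms index_sets by auto
  moreover have "{j. j < dim_col A \<and> j \<in> UNIV} = {..<n}" using assms(1) by auto
  ultimately show ?thesis
    using assms(3,4) by (simp only: select_rows_def submatrix_index pick_UNIV card_lessThan)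
qed

lemma pick_less: "r < card I \<Longrightarrow> pick I r < k" "r < card J \<Longrightarrow> pick J r < k"
  using index_sets pick_in_set by blast+

lemma merge_rows_carrier:
  assumes "B \<in> carrier_mat (card I) n" "M \<in> carrier_mat (card J) n"
  shows "merge_rows I B M \<in> carrier_mat k n"
  using assms card_index_sets by (intro carrier_matI) (simp_all add: merge_rows_def)

lemma merge_rows_index:
  assumes "B \<in> carrier_mat (card I) n" "M \<in> carrier_mat (card J) n" "i < k" "j < n"
  shows "i \<in> I \<Longrightarrow> merge_rows I B M $$ (i, j) = B $$ (card {a \<in> I. a < i}, j)"
    and "i \<in> J \<Longrightarrow> merge_rows I B M $$ (i, j) = M $$ (card {a \<in> J. a < i}, j)"
proof -
  \<comment> \<open>\<open>merge_rows\<close> ranks the remaining rows within the complement of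
    \<open>I\<close>; below \<open>i < k\<close> this complement coincides with
    \<open>J\<close>.\<close>
  have "{a. a \<notin> I \<and> a < i} = {a \<in> J. a < i}" using index_sets assms(3) by auto
  then show "i \<in> I \<Longrightarrow> merge_rows I B M $$ (i, j) = B $$ (card {a \<in> I. a < i}, j)"
    and "i \<in> J \<Longrightarrow> merge_rows I B M $$ (i, j) = M $$ (card {a \<in> J. a < i}, j)"
    using assms card_index_sets index_sets(3) by (auto simp: merge_rows_def)
qed

text \<open>Allows the two blocks to be perturbed independently: rank and \<open>pick\<close> are
  mutually inverse, so splitting the merged matrix recovers them.\<close>

lemma select_merge_rows:
  assumes B: "B \<in> carrier_mat (card I) n" and M: "M \<in> carrier_mat (card J) n"
  shows "select_rows (merge_rows I B M) I = B" "select_rows (merge_rows I B M) J = M"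
proof -
  note W = merge_rows_carrier[OF B M]
  show "select_rows (merge_rows I B M) I = B"
  proof (rule eq_matI)
    fix r j assume "r < dim_row B" "j < dim_col B"
    then have rj: "r < card I" "j < n" using B by auto
    then show "select_rows (merge_rows I B M) I $$ (r, j) = B $$ (r, j)"
      using select_rows_index[OF W _ rj] merge_rows_index(1)[OF B M pick_less(1)[OF rj(1)] rj(2)]
        pick_in_set[of r I] card_pick[of r I] by simp
  qed (use select_rows_carrier[OF W, of I] B in auto)
  show "select_rows (merge_rows I B M) J = M"
  proof (rule eq_matI)
    fix r j assume "r < dim_row M" "j < dim_col M"
    then have rj: "r < card J" "j < n" using M by auto
    then show "select_rows (merge_rows I B M) J $$ (r, j) = M $$ (r, j)"
      using select_rows_index[OF W _ rj] merge_rows_index(2)[OF B M pick_less(2)[OF rj(1)] rj(2)]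
        pick_in_set[of r J] card_pick[of r J] by simp
  qed (use select_rows_carrier[OF W, of J] M in auto)
qed

lemma select_rows_mult_vec:
  assumes A: "A \<in> carrier_mat k n" and K: "K = I \<or> K = J" and r: "r < card K"
    and x: "x \<in> carrier_vec n"
  shows "(select_rows A K *\<^sub>v x) $ r = (A *\<^sub>v x) $ (pick K r)"
proof -
  have p: "pick K r < k" using pick_less r K by auto
  show ?thesis
    using A x r p select_rows_carrier[OF A K] select_rows_index[OF A K r]
    by (simp add: scalar_prod_def)
qed

text \<open>Separates the stationarity condition along the row classes; the multipliers on
  \<open>J\<close> will turn out to be signs, those on \<open>I\<close> stay unknown.\<close>

lemma transpose_mult_vec_split:
  assumes A: "A \<in> carrier_mat k n" and z: "z \<in> carrier_vec k"
  shows "transpose_mat A *\<^sub>v z =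
    transpose_mat (select_rows A I) *\<^sub>v vec (card I) (\<lambda>r. z $ pick I r) +
    transpose_mat (select_rows A J) *\<^sub>v vec (card J) (\<lambda>r. z $ pick J r)"
proof -
  have part: "(transpose_mat (select_rows A K) *\<^sub>v vec (card K) (\<lambda>r. z $ pick K r)) $ j =
      (\<Sum>i\<in>K. A $$ (i, j) * z $ i)" if K: "K = I \<or> K = J" and j: "j < n" for K j
  proof -
    have "finite K" using K index_sets by auto
    have "(transpose_mat (select_rows A K) *\<^sub>v vec (card K) (\<lambda>r. z $ pick K r)) $ j =
        (\<Sum>r<card K. A $$ (pick K r, j) * z $ pick K r)"
      using select_rows_carrier[OF A K] select_rows_index[OF A K] j
      by (simp add: scalar_prod_def atLeast0LessThan)
    also have "\<dots> = (\<Sum>i\<in>K. A $$ (i, j) * z $ i)"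
      by (rule sum.reindex_bij_betw[OF bij_betw_pick[OF \<open>finite K\<close>]])
    finally show ?thesis .
  qed
  show ?thesis
  proof (rule eq_vecI)
    fix j assume "j < dim_vec (transpose_mat (select_rows A I) *\<^sub>v vec (card I) (\<lambda>r. z $ pick I r) +
      transpose_mat (select_rows A J) *\<^sub>v vec (card J) (\<lambda>r. z $ pick J r))"
    then have j: "j < n" using select_rows_carrier[OF A, of J] by auto
    have "(transpose_mat A *\<^sub>v z) $ j = (\<Sum>i\<in>I \<union> J. A $$ (i, j) * z $ i)"
      using A z j index_sets(4) by (simp add: scalar_prod_def atLeast0LessThan)
    also have "\<dots> = (\<Sum>i\<in>I. A $$ (i, j) * z $ i) + (\<Sum>i\<in>J. A $$ (i, j) * z $ i)"
      using index_sets by (intro sum.union_disjoint) auto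
    finally show "(transpose_mat A *\<^sub>v z) $ j =
      (transpose_mat (select_rows A I) *\<^sub>v vec (card I) (\<lambda>r. z $ pick I r) +
      transpose_mat (select_rows A J) *\<^sub>v vec (card J) (\<lambda>r. z $ pick J r)) $ j"
      using j part[of I j] part[of J j] select_rows_carrier[OF A, of J] by simp
  qed (use A select_rows_carrier[OF A, of J] in auto)
qed

text \<open>\<open>sgn\<close> keeps the zero pattern, so filtering leaves exactly the entries with
  index in \<open>J\<close>, in the order in which \<open>select_rows\<close> lists the
  rows.\<close>

lemma nonzero_entries_sgn:
  "nonzero_entries (map_vec sgn v) = vec (card J) (\<lambda>r. sgn (v $ pick J r))"
proof -
  let ?xs = "list_of_vec (map_vec sgn v)"
  have len: "length ?xs = k" using v by simp
  have nth: "?xs ! i = sgn (v $ i)" if "i < k" for i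
    using that v by (simp add: list_of_vec_index)
  have J': "{i. i < length ?xs \<and> ?xs ! i \<noteq> 0} = J"
    using v by (auto simp: J nonzero_indices_def list_of_vec_index sgn_eq_0_iff)
  have f: "filter (\<lambda>a. a \<noteq> 0) ?xs = nths ?xs J"
    using filter_eq_nths[of "\<lambda>a. a \<noteq> 0" ?xs] J' by simp
  have JJ: "{i. i < length ?xs \<and> i \<in> J} = J" using index_sets len by auto
  have "length (nths ?xs J) = card J" by (simp only: length_nths JJ)
  moreover have "nths ?xs J ! r = sgn (v $ pick J r)" if "r < card J" for r
    using nth_nths[of r ?xs J] that JJ nth pick_less(2)[OF that] by simp
  ultimately show ?thesis
    unfolding nonzero_entries_def f by (intro eq_vecI) (auto simp: vec_of_list_index)
qed

end

section \<open>Rank one perturbations of the optimality system\<close>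

lemma outer_prod_carrier [simp]:
  assumes "d \<in> carrier_vec m" "v \<in> carrier_vec n"
  shows "outer_prod d v \<in> carrier_mat m n"
  using assms by (intro carrier_matI) (simp_all add: outer_prod_def)

lemma outer_prod_dims [simp]:
  "dim_row (outer_prod d v) = dim_vec d" "dim_col (outer_prod d v) = dim_vec v"
  by (simp_all add: outer_prod_def)

lemma outer_prod_index:
  assumes "d \<in> carrier_vec m" "v \<in> carrier_vec n" "i < m" "j < n"
  shows "outer_prod d v $$ (i, j) = d $ i * v $ j"
  using assms by (simp add: outer_prod_def)

lemma rank_one_update_mult_vec:
  assumes B: "B \<in> carrier_mat m n" and d: "d \<in> carrier_vec m" and v: "v \<in> carrier_vec n"
    and x: "x \<in> carrier_vec n"
  shows "(B + \<tau> \<cdot>\<^sub>m outer_prod d v) *\<^sub>v x = B *\<^sub>v x + (\<tau> * (v \<bullet> x)) \<cdot>\<^sub>v d"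
proof (rule eq_vecI)
  fix i assume "i < dim_vec (B *\<^sub>v x + (\<tau> * (v \<bullet> x)) \<cdot>\<^sub>v d)"
  then have i: "i < m" using d by simp
  have "((B + \<tau> \<cdot>\<^sub>m outer_prod d v) *\<^sub>v x) $ i = (\<Sum>j<n. (B $$ (i, j) + \<tau> * (d $ i * v $ j)) * x $ j)"
    using assms i outer_prod_carrier[OF d v] outer_prod_index[OF d v i]
    by (simp add: scalar_prod_def atLeast0LessThan)
  also have "\<dots> = (\<Sum>j<n. B $$ (i, j) * x $ j) + \<tau> * (\<Sum>j<n. v $ j * x $ j) * d $ i"
    by (simp add: distrib_right sum.distrib sum_distrib_left sum_distrib_right algebra_simps)
  also have "\<dots> = (B *\<^sub>v x + (\<tau> * (v \<bullet> x)) \<cdot>\<^sub>v d) $ i"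
    using assms i by (simp add: scalar_prod_def atLeast0LessThan)
  finally show "((B + \<tau> \<cdot>\<^sub>m outer_prod d v) *\<^sub>v x) $ i = (B *\<^sub>v x + (\<tau> * (v \<bullet> x)) \<cdot>\<^sub>v d) $ i" .
qed (use assms outer_prod_carrier[OF d v] in simp)

lemma transpose_rank_one_update:
  assumes B: "B \<in> carrier_mat m n" and d: "d \<in> carrier_vec m" and v: "v \<in> carrier_vec n"
  shows "transpose_mat (B + \<tau> \<cdot>\<^sub>m outer_prod d v) = transpose_mat B + \<tau> \<cdot>\<^sub>m outer_prod v d"
  using assms outer_prod_carrier[OF d v] outer_prod_carrier[OF v d]
  by (intro eq_matI) (simp_all add: outer_prod_index[OF d v] outer_prod_index[OF v d])

lemma rank_one_update_close:
  fixes d v :: "real vec"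
  assumes B: "B \<in> carrier_mat m n" and d: "d \<in> carrier_vec m" and v: "v \<in> carrier_vec n"
    and e: "e > 0"
  shows "\<exists>\<tau>0>0. \<forall>\<tau> i j. \<bar>\<tau>\<bar> < \<tau>0 \<longrightarrow> i < m \<longrightarrow> j < n \<longrightarrow>
    \<bar>(B + \<tau> \<cdot>\<^sub>m outer_prod d v) $$ (i, j) - B $$ (i, j)\<bar> < e"
proof -
  \<comment> \<open>The product of the two absolute sums dominates every
    \<open>\<bar>d $ i * v $ j\<bar>\<close>; dividing by \<open>K + 1\<close> is safe even when
    \<open>K = 0\<close>.\<close>
  define K where "K = (\<Sum>i<m. \<bar>d $ i\<bar>) * (\<Sum>j<n. \<bar>v $ j\<bar>)"
  have K: "K \<ge> 0" by (simp add: K_def sum_nonneg)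
  show ?thesis
  proof (intro exI[of _ "e / (K + 1)"] conjI allI impI)
    show "e / (K + 1) > 0" using e K by simp
    fix \<tau> i j assume \<tau>: "\<bar>\<tau>\<bar> < e / (K + 1)" and i: "i < m" and j: "j < n"
    have "\<bar>(B + \<tau> \<cdot>\<^sub>m outer_prod d v) $$ (i, j) - B $$ (i, j)\<bar> = \<bar>\<tau>\<bar> * (\<bar>d $ i\<bar> * \<bar>v $ j\<bar>)"
      using B d v i j outer_prod_index[OF d v i j] by (simp add: abs_mult)
    also have "\<dots> \<le> \<bar>\<tau>\<bar> * K"
      unfolding K_def using i j
      by (intro mult_left_mono mult_mono member_le_sum) (auto intro: sum_nonneg)
    also have "\<dots> \<le> \<bar>\<tau>\<bar> * (K + 1)" by (simp add: mult_left_mono)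
    also have "\<dots> < e" using \<tau> K by (simp add: pos_less_divide_eq)
    finally show "\<bar>(B + \<tau> \<cdot>\<^sub>m outer_prod d v) $$ (i, j) - B $$ (i, j)\<bar> < e" .
  qed
qed

text \<open>
  Once the nonzero signs are fixed, the minimizer is the \<open>x\<close> of such a pair, with \<open>B\<close> the
  zero rows; the bound on \<open>z\<close> is all that remains of the subdifferential of the norm.
\<close>

definition kkt_pair :: "real mat \<Rightarrow> real vec \<Rightarrow> real vec \<Rightarrow> real vec \<Rightarrow> bool" where
  "kkt_pair B q x z \<longleftrightarrow> x \<in> carrier_vec (dim_col B) \<and> z \<in> carrier_vec (dim_row B) \<and>
     B *\<^sub>v x = 0\<^sub>v (dim_row B) \<and> q = x + transpose_mat B *\<^sub>v z \<and> (\<forall>i<dim_row B. \<bar>z $ i\<bar> \<le> 1)"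

lemma kkt_pairD:
  assumes "kkt_pair B q x z" "B \<in> carrier_mat m n"
  shows "x \<in> carrier_vec n" "z \<in> carrier_vec m" "B *\<^sub>v x = 0\<^sub>v m" "q = x + transpose_mat B *\<^sub>v z"
    "\<And>i. i < m \<Longrightarrow> \<bar>z $ i\<bar> \<le> 1" "q \<in> carrier_vec n"
  using assms by (auto simp: kkt_pair_def)

lemma scalar_prod_bound:
  assumes "\<And>i. i < m \<Longrightarrow> \<bar>z $ i\<bar> \<le> 1" "z \<in> carrier_vec m"
  shows "\<bar>d \<bullet> z\<bar> \<le> (\<Sum>i<m. \<bar>d $ i :: real\<bar>)"
proof -
  have "\<bar>d \<bullet> z\<bar> \<le> (\<Sum>i<m. \<bar>d $ i * z $ i\<bar>)"
    using assms(2) by (simp add: scalar_prod_def atLeast0LessThan sum_abs)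
  also have "\<dots> \<le> (\<Sum>i<m. \<bar>d $ i\<bar>)"
    using assms(1) by (intro sum_mono) (simp add: abs_mult mult_left_le)
  finally show ?thesis .
qed

lemma kkt_pair_scalar_prod:
  assumes k: "kkt_pair B q x z" and B: "B \<in> carrier_mat m n" and w: "w \<in> carrier_vec n"
  shows "q \<bullet> w = x \<bullet> w + z \<bullet> (B *\<^sub>v w)"
  using kkt_pairD[OF k B] B w
  by (simp add: add_scalar_prod_distrib[of _ n] transpose_vec_mult_scalar[OF B w])

text \<open>\<open>x\<close> is the orthogonal projection of \<open>q\<close> onto the kernel of
  \<open>B\<close>. The resulting bound on \<open>x\<close> depends on \<open>q\<close> alone and is
  therefore uniform under perturbations of \<open>B\<close>.\<close>

lemma kkt_pair_norm:
  assumes k: "kkt_pair B q x z" and B: "B \<in> carrier_mat m n"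
  shows "q \<bullet> x = x \<bullet> x" "x \<bullet> x \<le> q \<bullet> q"
proof -
  note kd = kkt_pairD[OF k B]
  show *: "q \<bullet> x = x \<bullet> x"
    using kkt_pair_scalar_prod[OF k B kd(1)] kd by simp
  have "(q - x) \<bullet> (q - x) = q \<bullet> q - x \<bullet> x"
    using scalar_prod_minus_self[OF kd(6) kd(1)] * by simp
  then show "x \<bullet> x \<le> q \<bullet> q" using scalar_prod_self_nonneg[of "q - x"] by simp
qed

text \<open>Separates the perturbation from \<open>B\<close>, so that facts about \<open>B\<close>
  alone apply to the perturbed solution.\<close>

lemma kkt_pair_rank_one:
  assumes k: "kkt_pair (B + \<tau> \<cdot>\<^sub>m outer_prod d v) q x z"
    and B: "B \<in> carrier_mat m n" and d: "d \<in> carrier_vec m" and v: "v \<in> carrier_vec n"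
  shows "x \<in> carrier_vec n" "z \<in> carrier_vec m"
    "B *\<^sub>v x + (\<tau> * (v \<bullet> x)) \<cdot>\<^sub>v d = 0\<^sub>v m"
    "q = x + (transpose_mat B *\<^sub>v z + (\<tau> * (d \<bullet> z)) \<cdot>\<^sub>v v)"
    "\<And>i. i < m \<Longrightarrow> \<bar>z $ i\<bar> \<le> 1"
proof -
  have B': "B + \<tau> \<cdot>\<^sub>m outer_prod d v \<in> carrier_mat m n"
    using B d v by simp
  note kd = kkt_pairD[OF k B']
  show "x \<in> carrier_vec n" "z \<in> carrier_vec m" "\<And>i. i < m \<Longrightarrow> \<bar>z $ i\<bar> \<le> 1"
    using kd by auto
  show "B *\<^sub>v x + (\<tau> * (v \<bullet> x)) \<cdot>\<^sub>v d = 0\<^sub>v m"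
    using kd(3) rank_one_update_mult_vec[OF B d v kd(1)] by simp
  show "q = x + (transpose_mat B *\<^sub>v z + (\<tau> * (d \<bullet> z)) \<cdot>\<^sub>v v)"
    using kd(4) transpose_rank_one_update[OF B d v]
      rank_one_update_mult_vec[of "transpose_mat B" n m v d z] B d v kd(2) by simp
qed

text \<open>
  If neither the rows nor the columns of \<open>B\<close> are independent, then solvability for all nearby
  matrices forces \<open>q = 0\<close>: rank one perturbations \<open>\<tau> d v\<^sup>T\<close> with \<open>v\<close> in the kernel push
  \<open>v\<close> into the row space, and solvability with a bounded \<open>z\<close> for every such \<open>d\<close> is too much.
\<close>

lemma kkt_pair_rank_alternative:
  fixes B :: "real mat"
  assumes B: "B \<in> carrier_mat m n" and k0: "kkt_pair B q x0 z0" and e: "e > 0"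
    and solv: "\<And>B'. B' \<in> carrier_mat m n \<Longrightarrow>
        (\<And>i j. i < m \<Longrightarrow> j < n \<Longrightarrow> \<bar>B' $$ (i, j) - B $$ (i, j)\<bar> < e) \<Longrightarrow> \<exists>x z. kkt_pair B' q x z"
    and c: "c \<in> carrier_vec m" "c \<noteq> 0\<^sub>v m" "transpose_mat B *\<^sub>v c = 0\<^sub>v n"
    and v: "v \<in> carrier_vec n" "v \<noteq> 0\<^sub>v n" "B *\<^sub>v v = 0\<^sub>v m"
  shows "q = 0\<^sub>v n"
proof -
  note kd0 = kkt_pairD[OF k0 B]
  have cB: "c \<bullet> (B *\<^sub>v w) = 0" if "w \<in> carrier_vec n" for w
    using transpose_vec_mult_scalar[OF B that c(1)] c(3) that by simp
  have cc: "c \<bullet> c > 0"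
    using scalar_prod_self_eq_0[OF c(1)] c(2) scalar_prod_self_nonneg[of c] by simp
  define C where "C = (\<Sum>i<m. \<bar>c $ i\<bar>)"
  have "C \<ge> 0" by (simp add: C_def sum_nonneg)
  \<comment> \<open>Pairing the perturbed constraint with \<open>c\<close> removes
    \<open>B x\<close>, as \<open>c\<close> is orthogonal to the columns of \<open>B\<close>, and
    leaves \<open>\<tau> * (w \<bullet> x) * (c \<bullet> d) = 0\<close>. Since
    \<open>c \<bullet> d\<close> is positive, \<open>x\<close> is orthogonal to \<open>w\<close> and
    remains in the kernel of \<open>B\<close>.\<close>
  have pert: "\<exists>\<tau>0>0. \<forall>\<tau>. 0 < \<tau> \<longrightarrow> \<tau> < \<tau>0 \<longrightarrow> (\<exists>x z. x \<in> carrier_vec n \<and> z \<in> carrier_vec m \<and>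
      w \<bullet> x = 0 \<and> B *\<^sub>v x = 0\<^sub>v m \<and> q = x + (transpose_mat B *\<^sub>v z + (\<tau> * (d \<bullet> z)) \<cdot>\<^sub>v w) \<and> \<bar>c \<bullet> z\<bar> \<le> C)"
    if d: "d \<in> carrier_vec m" and w: "w \<in> carrier_vec n" "B *\<^sub>v w = 0\<^sub>v m" and cd: "c \<bullet> d = c \<bullet> c"
    for d w
  proof -
    obtain \<tau>0 where \<tau>0: "\<tau>0 > 0" "\<forall>\<tau> i j. \<bar>\<tau>\<bar> < \<tau>0 \<longrightarrow> i < m \<longrightarrow> j < n \<longrightarrow>
        \<bar>(B + \<tau> \<cdot>\<^sub>m outer_prod d w) $$ (i, j) - B $$ (i, j)\<bar> < e"
      using rank_one_update_close[OF B d w(1) e] by (elim exE conjE) (rule that)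
    have "\<exists>x z. x \<in> carrier_vec n \<and> z \<in> carrier_vec m \<and>
      w \<bullet> x = 0 \<and> B *\<^sub>v x = 0\<^sub>v m \<and> q = x + (transpose_mat B *\<^sub>v z + (\<tau> * (d \<bullet> z)) \<cdot>\<^sub>v w) \<and> \<bar>c \<bullet> z\<bar> \<le> C"
      if \<tau>: "0 < \<tau>" "\<tau> < \<tau>0" for \<tau>
    proof -
      obtain x z where "kkt_pair (B + \<tau> \<cdot>\<^sub>m outer_prod d w) q x z"
        using solv[of "B + \<tau> \<cdot>\<^sub>m outer_prod d w"] \<tau>0(2)[THEN spec, of \<tau>] \<tau> B d w(1) by auto
      note kr = kkt_pair_rank_one[OF this B d w(1)]
      have "c \<bullet> (B *\<^sub>v x + (\<tau> * (w \<bullet> x)) \<cdot>\<^sub>v d) = 0"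
        using kr(3) c(1) by simp
      moreover have "c \<bullet> (B *\<^sub>v x + (\<tau> * (w \<bullet> x)) \<cdot>\<^sub>v d) = c \<bullet> (B *\<^sub>v x) + \<tau> * (w \<bullet> x) * (c \<bullet> d)"
        using B d c(1) kr(1) by (simp add: scalar_prod_add_distrib[of _ m])
      ultimately have wx: "w \<bullet> x = 0" using cB[OF kr(1)] cc cd \<tau> by simp
      have "(\<tau> * (w \<bullet> x)) \<cdot>\<^sub>v d = 0\<^sub>v m" using d wx by (intro eq_vecI) auto
      then have "B *\<^sub>v x = 0\<^sub>v m" using kr(3) B kr(1) by simp
      moreover have "\<bar>c \<bullet> z\<bar> \<le> C" unfolding C_def by (rule scalar_prod_bound[OF kr(5) kr(2)])
      ultimately show ?thesis using kr(1,2,4) wx by blast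
    qed
    then show ?thesis using \<tau>0(1) by blast
  qed
  have dot: "q \<bullet> w = x \<bullet> w + \<tau> * (d \<bullet> z) * (w \<bullet> w)"
    if "q = x + (transpose_mat B *\<^sub>v z + (\<tau> * (d \<bullet> z)) \<cdot>\<^sub>v w)" "x \<in> carrier_vec n"
      "z \<in> carrier_vec m" "w \<in> carrier_vec n" "B *\<^sub>v w = 0\<^sub>v m" for x z w d \<tau>
    using that B
    by (simp add: add_scalar_prod_distrib[of _ n] transpose_vec_mult_scalar[OF B])
  have dot0: "q \<bullet> w = x0 \<bullet> w" if "w \<in> carrier_vec n" "B *\<^sub>v w = 0\<^sub>v m" for w
    using kkt_pair_scalar_prod[OF k0 B that(1)] that(2) kd0(2) by simp
  \<comment> \<open>Perturb in the direction \<open>w = x0\<close> with \<open>d = c\<close>.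
    Pairing \<open>q\<close> with \<open>x0\<close> gives
    \<open>\<tau> * (c \<bullet> z) = 1\<close> unless \<open>x0\<close> vanishes, which is
    impossible for \<open>\<tau> \<le> 1 / (C + 1)\<close> and
    \<open>c \<bullet> z \<le> C\<close>.\<close>
  have "x0 \<bullet> x0 = 0"
  proof (rule ccontr)
    assume "x0 \<bullet> x0 \<noteq> 0"
    then have xx: "x0 \<bullet> x0 > 0" using scalar_prod_self_nonneg[of x0] by simp
    obtain \<tau>0 where \<tau>0: "\<tau>0 > 0" and t: "\<forall>\<tau>. 0 < \<tau> \<longrightarrow> \<tau> < \<tau>0 \<longrightarrow> (\<exists>x z. x \<in> carrier_vec n \<and>
      z \<in> carrier_vec m \<and> x0 \<bullet> x = 0 \<and> B *\<^sub>v x = 0\<^sub>v m \<and>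
      q = x + (transpose_mat B *\<^sub>v z + (\<tau> * (c \<bullet> z)) \<cdot>\<^sub>v x0) \<and> \<bar>c \<bullet> z\<bar> \<le> C)"
      using pert[OF c(1) kd0(1) kd0(3) refl] by (elim exE conjE) (rule that)
    define \<tau> where "\<tau> = min (\<tau>0 / 2) (1 / (C + 1))"
    have \<tau>: "0 < \<tau>" "\<tau> < \<tau>0" using \<tau>0 \<open>C \<ge> 0\<close> by (auto simp: \<tau>_def)
    obtain x z where xz: "x \<in> carrier_vec n" "z \<in> carrier_vec m" "x0 \<bullet> x = 0"
      "q = x + (transpose_mat B *\<^sub>v z + (\<tau> * (c \<bullet> z)) \<cdot>\<^sub>v x0)" "\<bar>c \<bullet> z\<bar> \<le> C"
      using t[THEN spec, THEN mp, THEN mp, OF \<tau>] by (elim exE conjE) (rule that)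
    have "x \<bullet> x0 = 0" using comm_scalar_prod[OF xz(1) kd0(1)] xz(3) by simp
    then have "x0 \<bullet> x0 = \<tau> * (c \<bullet> z) * (x0 \<bullet> x0)"
      using dot[OF xz(4,1,2) kd0(1,3)] dot0[OF kd0(1,3)] by simp
    then have "\<tau> * (c \<bullet> z) = 1" using xx by simp
    moreover have "\<tau> * (c \<bullet> z) \<le> 1 / (C + 1) * C"
    proof -
      have "\<tau> * (c \<bullet> z) \<le> \<tau> * C" using xz(5) \<tau>(1) by (intro mult_left_mono) auto
      also have "\<dots> \<le> 1 / (C + 1) * C"
        using \<open>C \<ge> 0\<close> by (intro mult_right_mono) (simp_all add: \<tau>_def)
      finally show ?thesis .
    qed
    moreover have "1 / (C + 1) * C < 1" using \<open>C \<ge> 0\<close> by simp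
    ultimately show False by simp
  qed
  then have x0: "x0 = 0\<^sub>v n" using scalar_prod_self_eq_0[OF kd0(1)] by simp
  show ?thesis
  proof (rule ccontr)
    assume "q \<noteq> 0\<^sub>v n"
    then have qq: "q \<bullet> q > 0"
      using scalar_prod_self_eq_0[OF kd0(6)] scalar_prod_self_nonneg[of q] by simp
    \<comment> \<open>Now \<open>x0 = 0\<close>. Pairing \<open>q\<close> with \<open>v\<close> will
      give \<open>d \<bullet> z = 0\<close>, and pairing it with itself
      \<open>(B *\<^sub>v q) \<bullet> z = q \<bullet> q\<close>. The scale \<open>\<mu>\<close> is
      chosen so that \<open>d \<bullet> z = c \<bullet> z + C + 1\<close>, which is positive: a
      contradiction.\<close>
    define \<mu> where "\<mu> = (C + 1) / (q \<bullet> q)"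
    define d where "d = c + \<mu> \<cdot>\<^sub>v (B *\<^sub>v q)"
    have Bq: "B *\<^sub>v q \<in> carrier_vec m" using B kd0(6) by simp
    have d: "d \<in> carrier_vec m" using c(1) Bq by (simp add: d_def)
    have "c \<bullet> d = c \<bullet> c"
      using c(1) Bq cB[OF kd0(6)] by (simp add: d_def scalar_prod_add_distrib[of _ m])
    from pert[OF d v(1,3) this]
    obtain \<tau>0 where \<tau>0: "\<tau>0 > 0" and t: "\<forall>\<tau>. 0 < \<tau> \<longrightarrow> \<tau> < \<tau>0 \<longrightarrow> (\<exists>x z. x \<in> carrier_vec n \<and>
      z \<in> carrier_vec m \<and> v \<bullet> x = 0 \<and> B *\<^sub>v x = 0\<^sub>v m \<and>
      q = x + (transpose_mat B *\<^sub>v z + (\<tau> * (d \<bullet> z)) \<cdot>\<^sub>v v) \<and> \<bar>c \<bullet> z\<bar> \<le> C)"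
      by (elim exE conjE) (rule that)
    have "0 < \<tau>0 / 2" "\<tau>0 / 2 < \<tau>0" using \<tau>0 by auto
    from t[THEN spec, THEN mp, THEN mp, OF this]
    obtain x z where xz: "x \<in> carrier_vec n" "z \<in> carrier_vec m" "v \<bullet> x = 0" "B *\<^sub>v x = 0\<^sub>v m"
      "q = x + (transpose_mat B *\<^sub>v z + (\<tau>0 / 2 * (d \<bullet> z)) \<cdot>\<^sub>v v)" "\<bar>c \<bullet> z\<bar> \<le> C"
      by (elim exE conjE) (rule that)
    have vv: "v \<bullet> v > 0"
      using scalar_prod_self_eq_0[OF v(1)] v(2) scalar_prod_self_nonneg[of v] by simp
    have "x \<bullet> v = 0" using comm_scalar_prod[OF xz(1) v(1)] xz(3) by simp
    moreover have "q \<bullet> v = 0" using dot0[OF v(1,3)] x0 v(1) by simp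
    ultimately have "\<tau>0 / 2 * (d \<bullet> z) * (v \<bullet> v) = 0" using dot[OF xz(5,1,2) v(1,3)] by simp
    then have dz: "d \<bullet> z = 0" using vv \<tau>0 by simp
    have "(\<tau>0 / 2 * (d \<bullet> z)) \<cdot>\<^sub>v v = 0\<^sub>v n" using v(1) dz by (intro eq_vecI) auto
    then have q: "q = x + transpose_mat B *\<^sub>v z" using xz(1,2,5) B by simp
    have "q \<bullet> q = (x + transpose_mat B *\<^sub>v z) \<bullet> q" using q by simp
    also have "\<dots> = x \<bullet> q + z \<bullet> (B *\<^sub>v q)"
      using B kd0(6) xz(1,2)
      by (simp add: add_scalar_prod_distrib[of _ n] transpose_vec_mult_scalar[OF B])
    also have "x \<bullet> q = 0"
      using comm_scalar_prod[OF xz(1) kd0(6)] dot0[OF xz(1,4)] x0 xz(1) by simp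
    also have "z \<bullet> (B *\<^sub>v q) = (B *\<^sub>v q) \<bullet> z" by (rule comm_scalar_prod[OF xz(2) Bq])
    finally have "(B *\<^sub>v q) \<bullet> z = q \<bullet> q" by simp
    moreover have "d \<bullet> z = c \<bullet> z + \<mu> * ((B *\<^sub>v q) \<bullet> z)"
      using c(1) Bq xz(2) by (simp add: d_def add_scalar_prod_distrib[of _ m])
    ultimately have "c \<bullet> z + (C + 1) = 0" using dz qq by (simp add: \<mu>_def)
    then show False using xz(6) by simp
  qed
qed

section \<open>Dependence of the solution on the zero rows\<close>

context
  fixes B X P :: "real mat" and m n :: nat
  assumes B: "B \<in> carrier_mat m n" and pinv: "is_pseudo_inverse B X" and P: "P = 1\<^sub>m n - X * B"
begin

section \<open>Projector identities for a fixed pseudoinverse\<close>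

lemma pinv_carrier: "X \<in> carrier_mat n m" "X * B \<in> carrier_mat n n" "B * X \<in> carrier_mat m m"
    "P \<in> carrier_mat n n"
  using pinv B by (auto simp: is_pseudo_inverse_def P)

lemma pinv_eqs: "B * (X * B) = B" "X * B * X = X" "transpose_mat (B * X) = B * X"
    "transpose_mat (X * B) = X * B"
  using pinv B pinv_carrier(1) by (auto simp: is_pseudo_inverse_def)

lemma transpose_null_projector: "transpose_mat P = P"
  unfolding P using transpose_minus[OF one_carrier_mat pinv_carrier(2)] pinv_eqs(4) by simp

lemma null_projector_mult_vec:
  assumes "w \<in> carrier_vec n"
  shows "P *\<^sub>v w = w - X *\<^sub>v (B *\<^sub>v w)"
  unfolding P using assms B pinv_carrier
  by (simp add: minus_mult_distrib_mat_vec[of _ n n])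

lemma mult_null_projector_vec:
  assumes "w \<in> carrier_vec n"
  shows "B *\<^sub>v (P *\<^sub>v w) = 0\<^sub>v m"
proof -
  have "B *\<^sub>v (X *\<^sub>v (B *\<^sub>v w)) = (B * (X * B)) *\<^sub>v w"
    using assms B pinv_carrier(1) by (simp add: assoc_mult_mat_vec[of _ m n _ n] assoc_mult_mat_vec[of _ n m _ n])
  also have "\<dots> = B *\<^sub>v w" by (simp only: pinv_eqs)
  finally show ?thesis
    using assms B pinv_carrier(1)
    by (simp add: null_projector_mult_vec mult_minus_distrib_mat_vec[of _ m n])
qed

lemma null_projector_kernel:
  assumes "w \<in> carrier_vec n" "B *\<^sub>v w = 0\<^sub>v m"
  shows "P *\<^sub>v w = w"
proof -
  have "X *\<^sub>v 0\<^sub>v m = 0\<^sub>v n" using pinv_carrier(1) by auto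
  then show ?thesis using assms null_projector_mult_vec by simp
qed

text \<open>\<open>X * B\<close> is symmetric, so it acts on the columns of the transpose of
  \<open>B\<close> as the transpose of \<open>B * (X * B) = B\<close> and fixes them.\<close>

lemma null_projector_row_space:
  assumes "w \<in> carrier_vec m"
  shows "P *\<^sub>v (transpose_mat B *\<^sub>v w) = 0\<^sub>v n"
proof -
  have Bt: "transpose_mat B *\<^sub>v w \<in> carrier_vec n" using B assms by simp
  have "X *\<^sub>v (B *\<^sub>v (transpose_mat B *\<^sub>v w)) = (X * B) *\<^sub>v (transpose_mat B *\<^sub>v w)"
    using assoc_mult_mat_vec[OF pinv_carrier(1) B Bt] by simp
  also have "\<dots> = transpose_mat (X * B) *\<^sub>v (transpose_mat B *\<^sub>v w)" by (simp only: pinv_eqs)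
  also have "\<dots> = (transpose_mat (X * B) * transpose_mat B) *\<^sub>v w"
    using assoc_mult_mat_vec[of "transpose_mat (X * B)" n n "transpose_mat B" m w] B assms pinv_carrier(2)
    by simp
  also have "transpose_mat (X * B) * transpose_mat B = transpose_mat (B * (X * B))"
    using transpose_mult[OF B pinv_carrier(2)] by simp
  also have "\<dots> = transpose_mat B" by (simp only: pinv_eqs)
  finally show ?thesis using null_projector_mult_vec[OF Bt] Bt by simp
qed

text \<open>\<open>B * X\<close> is the orthogonal projector onto the column space. The residual is
  the source of left kernel vectors for \<open>kkt_pair_rank_alternative\<close>.\<close>

lemma left_null_vec:
  assumes w: "w \<in> carrier_vec m"
  shows "transpose_mat B *\<^sub>v (w - B *\<^sub>v (X *\<^sub>v w)) = 0\<^sub>v n"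
proof -
  have "transpose_mat B *\<^sub>v (B *\<^sub>v (X *\<^sub>v w)) = transpose_mat B *\<^sub>v ((B * X) *\<^sub>v w)"
    using assoc_mult_mat_vec[OF B pinv_carrier(1) w] by simp
  also have "\<dots> = transpose_mat B *\<^sub>v (transpose_mat (B * X) *\<^sub>v w)" by (simp only: pinv_eqs)
  also have "\<dots> = (transpose_mat B * transpose_mat (B * X)) *\<^sub>v w"
    using assoc_mult_mat_vec[of "transpose_mat B" n m "transpose_mat (B * X)" m w] B w pinv_carrier(3)
    by simp
  also have "transpose_mat B * transpose_mat (B * X) = transpose_mat ((B * X) * B)"
    using transpose_mult[OF pinv_carrier(3) B] by simp
  also have "(B * X) * B = B"
    using assoc_mult_mat[OF B pinv_carrier(1) B] pinv_eqs(1) by simp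
  finally show ?thesis
    using B w pinv_carrier(1) by (simp add: mult_minus_distrib_mat_vec[of _ n m])
qed

text \<open>\<open>X *\<^sub>v w\<close> is fixed by the symmetric matrix \<open>X * B\<close>, and
  moving that matrix to the other side of the product annihilates \<open>x\<close>.\<close>

lemma pinv_range_orthogonal:
  assumes w: "w \<in> carrier_vec m" and x: "x \<in> carrier_vec n" "B *\<^sub>v x = 0\<^sub>v m"
  shows "(X *\<^sub>v w) \<bullet> x = 0"
proof -
  have u: "X *\<^sub>v w \<in> carrier_vec n" using w pinv_carrier(1) by simp
  have "X *\<^sub>v w = (X * B * X) *\<^sub>v w" by (simp only: pinv_eqs)
  also have "\<dots> = (X * B) *\<^sub>v (X *\<^sub>v w)"
    by (rule assoc_mult_mat_vec[OF pinv_carrier(2) pinv_carrier(1) w])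
  also have "\<dots> = transpose_mat (X * B) *\<^sub>v (X *\<^sub>v w)" by (simp only: pinv_eqs)
  finally have "(X *\<^sub>v w) \<bullet> x = (transpose_mat (X * B) *\<^sub>v (X *\<^sub>v w)) \<bullet> x" by simp
  also have "\<dots> = (X *\<^sub>v w) \<bullet> ((X * B) *\<^sub>v x)"
    by (rule transpose_vec_mult_scalar[OF pinv_carrier(2) x(1) u])
  also have "(X * B) *\<^sub>v x = X *\<^sub>v (B *\<^sub>v x)"
    by (rule assoc_mult_mat_vec[OF pinv_carrier(1) B x(1)])
  also have "\<dots> = 0\<^sub>v n" using x(2) pinv_carrier(1) by auto
  finally show ?thesis using u by simp
qed

text \<open>\<open>q\<close> is the sum of a kernel vector \<open>x\<close> and a row space vector,
  and \<open>P\<close> keeps only the former. Hence \<open>x\<close> is determined by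
  \<open>B\<close> and \<open>q\<close>, whichever \<open>z\<close> accompanies it.\<close>

lemma kkt_pair_null_projector:
  assumes "kkt_pair B q x z"
  shows "P *\<^sub>v q = x"
proof -
  note kd = kkt_pairD[OF assms B]
  have "P *\<^sub>v q = P *\<^sub>v x + P *\<^sub>v (transpose_mat B *\<^sub>v z)"
    unfolding kd(4) using kd(1,2) B pinv_carrier(4) by (intro mult_add_distrib_mat_vec) auto
  then show ?thesis
    using null_projector_kernel[OF kd(1,3)] null_projector_row_space[OF kd(2)] kd(1) by simp
qed

text \<open>Applying \<open>X\<close> to the perturbed constraint gives the row space part of
  \<open>x\<close>, and applying \<open>P\<close> to the perturbed stationarity equation gives its
  kernel part. The identity is exact; the \<open>x\<close> and \<open>z\<close> on its right side
  are the perturbed ones.\<close>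

lemma kkt_pair_displacement:
  assumes k0: "kkt_pair B q x0 z0" and k: "kkt_pair (B + \<tau> \<cdot>\<^sub>m outer_prod d v) q x z"
    and d: "d \<in> carrier_vec m" and v: "v \<in> carrier_vec n" and a: "a < n"
  shows "x $ a = x0 $ a - \<tau> * ((v \<bullet> x) * (X *\<^sub>v d) $ a + (d \<bullet> z) * (P *\<^sub>v v) $ a)"
proof -
  note kr = kkt_pair_rank_one[OF k B d v]
  have Bx: "B *\<^sub>v x \<in> carrier_vec m" using B kr(1) by simp
  have "X *\<^sub>v (B *\<^sub>v x + (\<tau> * (v \<bullet> x)) \<cdot>\<^sub>v d) = 0\<^sub>v n"
    using kr(3) pinv_carrier(1) by auto
  moreover have "X *\<^sub>v (B *\<^sub>v x + (\<tau> * (v \<bullet> x)) \<cdot>\<^sub>v d) =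
      X *\<^sub>v (B *\<^sub>v x) + (\<tau> * (v \<bullet> x)) \<cdot>\<^sub>v (X *\<^sub>v d)"
    using Bx d pinv_carrier(1)
    by (simp add: mult_add_distrib_mat_vec[of _ n m] mult_mat_vec[of _ n m])
  ultimately have "(X *\<^sub>v (B *\<^sub>v x) + (\<tau> * (v \<bullet> x)) \<cdot>\<^sub>v (X *\<^sub>v d)) $ a = 0"
    using a by simp
  then have 1: "(X *\<^sub>v (B *\<^sub>v x)) $ a = - (\<tau> * (v \<bullet> x)) * (X *\<^sub>v d) $ a"
    using a d Bx pinv_carrier(1) by (simp del: index_mult_mat_vec)
  have 2: "(P *\<^sub>v x) $ a = x $ a - (X *\<^sub>v (B *\<^sub>v x)) $ a"
    unfolding null_projector_mult_vec[OF kr(1)] using a kr(1) Bx pinv_carrier(1)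
    by (simp del: index_mult_mat_vec)
  have Bt: "transpose_mat B *\<^sub>v z \<in> carrier_vec n" using B kr(2) by simp
  have "x0 = P *\<^sub>v q" using kkt_pair_null_projector[OF k0] by simp
  also have "\<dots> = P *\<^sub>v x + (0\<^sub>v n + (\<tau> * (d \<bullet> z)) \<cdot>\<^sub>v (P *\<^sub>v v))"
    unfolding kr(4) using kr(1) Bt v pinv_carrier(4) null_projector_row_space[OF kr(2)]
    by (simp add: mult_add_distrib_mat_vec[of _ n n] mult_mat_vec[of _ n n])
  finally have "x0 $ a = (P *\<^sub>v x + (0\<^sub>v n + (\<tau> * (d \<bullet> z)) \<cdot>\<^sub>v (P *\<^sub>v v))) $ a" by simp
  also have "\<dots> = (P *\<^sub>v x) $ a + \<tau> * (d \<bullet> z) * (P *\<^sub>v v) $ a"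
    using a v kr(1) pinv_carrier(4) by (simp del: index_mult_mat_vec)
  finally show ?thesis using 1 2 by (simp add: algebra_simps)
qed

text \<open>Dividing the displacement identity by \<open>\<tau>\<close> leaves only the limits of
  one entry of the solution and one entry of the multiplier to be found. The function
  \<open>x\<close> is constrained only near \<open>B\<close>, through \<open>solv\<close>.\<close>

lemma kkt_solution_has_derivative:
  fixes x :: "real mat \<Rightarrow> real vec"
  assumes e: "e > 0"
    and solv: "\<And>B'. B' \<in> carrier_mat m n \<Longrightarrow>
        (\<And>i j. i < m \<Longrightarrow> j < n \<Longrightarrow> \<bar>B' $$ (i, j) - B $$ (i, j)\<bar> < e) \<Longrightarrow> \<exists>z. kkt_pair B' q (x B') z"
    and r: "r < m" and j: "j < n" and a: "a < n"
  shows "((\<lambda>\<tau>. x (B + \<tau> \<cdot>\<^sub>m outer_prod (unit_vec m r) (unit_vec n j)) $ a) has_real_derivative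
    - (x B $ j * X $$ (a, r) + ((X *\<^sub>v unit_vec m r) \<bullet> q) * P $$ (a, j))) (at 0)"
proof -
  define d v where "d = (unit_vec m r :: real vec)" and "v = (unit_vec n j :: real vec)"
  have d: "d \<in> carrier_vec m" and v: "v \<in> carrier_vec n" by (simp_all add: d_def v_def)
  define \<xi> where "\<xi> \<tau> = x (B + \<tau> \<cdot>\<^sub>m outer_prod d v)" for \<tau>
  define u where "u = X *\<^sub>v d"
  have u: "u \<in> carrier_vec n" using d pinv_carrier(1) by (simp add: u_def)
  have "B + 0 \<cdot>\<^sub>m outer_prod d v = B" using B d v by (intro eq_matI) auto
  then have \<xi>0: "\<xi> 0 = x B" by (simp add: \<xi>_def)
  obtain z0 where k0: "kkt_pair B q (x B) z0" using solv[OF B] e by auto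
  note kd0 = kkt_pairD[OF k0 B]
  obtain \<tau>0 where \<tau>0: "\<tau>0 > 0" and close: "\<forall>\<tau> i j. \<bar>\<tau>\<bar> < \<tau>0 \<longrightarrow> i < m \<longrightarrow> j < n \<longrightarrow>
        \<bar>(B + \<tau> \<cdot>\<^sub>m outer_prod d v) $$ (i, j) - B $$ (i, j)\<bar> < e"
    using rank_one_update_close[OF B d v e] by (elim exE conjE) (rule that)
  \<comment> \<open>The smallness condition sits under the quantifier so that \<open>choice\<close>
    yields a multiplier function \<open>Z\<close> on all reals.\<close>
  have "\<exists>z. \<bar>\<tau>\<bar> < \<tau>0 \<longrightarrow> kkt_pair (B + \<tau> \<cdot>\<^sub>m outer_prod d v) q (\<xi> \<tau>) z" for \<tau>
  proof (cases "\<bar>\<tau>\<bar> < \<tau>0")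
    case True
    have "B + \<tau> \<cdot>\<^sub>m outer_prod d v \<in> carrier_mat m n" using B d v by simp
    from solv[OF this] close[THEN spec, of \<tau>] True show ?thesis by (simp add: \<xi>_def)
  qed simp
  then have "\<forall>\<tau>. \<exists>z. \<bar>\<tau>\<bar> < \<tau>0 \<longrightarrow> kkt_pair (B + \<tau> \<cdot>\<^sub>m outer_prod d v) q (\<xi> \<tau>) z" by simp
  from choice[OF this]
  obtain Z where Z: "\<forall>\<tau>. \<bar>\<tau>\<bar> < \<tau>0 \<longrightarrow> kkt_pair (B + \<tau> \<cdot>\<^sub>m outer_prod d v) q (\<xi> \<tau>) (Z \<tau>)"
    by (elim exE) (rule that)
  have kk: "kkt_pair (B + \<tau> \<cdot>\<^sub>m outer_prod d v) q (\<xi> \<tau>) (Z \<tau>)" if "\<bar>\<tau>\<bar> < \<tau>0" for \<tau>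
    using Z that by simp
  have B': "B + \<tau> \<cdot>\<^sub>m outer_prod d v \<in> carrier_mat m n" for \<tau> using B d v by simp
  have dot: "v \<bullet> w = w $ j" if "w \<in> carrier_vec n" for w using that j by (simp add: v_def)
  have dotd: "d \<bullet> w = w $ r" if "w \<in> carrier_vec m" for w using that r by (simp add: d_def)
  have Xd: "(X *\<^sub>v d) $ i = X $$ (i, r)" if "i < n" for i
    using pinv_carrier(1) r that by (simp add: d_def)
  have Pv: "(P *\<^sub>v v) $ i = P $$ (i, j)" if "i < n" for i
    using pinv_carrier(4) j that by (simp add: v_def)
  have disp: "\<xi> \<tau> $ i = x B $ i - \<tau> * (\<xi> \<tau> $ j * X $$ (i, r) + Z \<tau> $ r * P $$ (i, j))"
    if "\<bar>\<tau>\<bar> < \<tau>0" "i < n" for \<tau> i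
  proof -
    note kr = kkt_pair_rank_one[OF kk[OF that(1)] B d v]
    show ?thesis
      using kkt_pair_displacement[OF k0 kk[OF that(1)] d v that(2)]
      unfolding dot[OF kr(1)] dotd[OF kr(2)] Xd[OF that(2)] Pv[OF that(2)] .
  qed
  have ev: "\<forall>\<^sub>F \<tau> in at 0. \<bar>\<tau>\<bar> < \<tau>0"
    unfolding eventually_at using \<tau>0 by (intro exI[of _ \<tau>0]) auto
  define D where "D = - (x B $ j * X $$ (a, r) + (u \<bullet> q) * P $$ (a, j))"
  have quot: "((\<lambda>h. (\<xi> h $ a - x B $ a) / h) \<longlongrightarrow> D) (at 0)"
  proof (cases "q = 0\<^sub>v n")
    case True
    \<comment> \<open>Solutions are bounded in norm by \<open>q\<close>, so for \<open>q = 0\<close>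
      they vanish for all small \<open>\<tau>\<close>, as does the claimed derivative.\<close>
    have zero: "w = 0\<^sub>v n" if "kkt_pair A q w z" "A \<in> carrier_mat m n" for A w z
    proof -
      have "q \<bullet> q = 0" using True by simp
      then have "w \<bullet> w = 0"
        using kkt_pair_norm(2)[OF that] scalar_prod_self_nonneg[of w] by simp
      then show ?thesis using scalar_prod_self_eq_0[OF kkt_pairD(1)[OF that]] by simp
    qed
    have x0: "x B = 0\<^sub>v n" by (rule zero[OF k0 B])
    have "D = 0" using True u j by (simp add: D_def x0)
    moreover have "\<forall>\<^sub>F h in at 0. 0 = (\<xi> h $ a - x B $ a) / h"
      using ev
    proof eventually_elim
      case (elim h)
      have "\<xi> h = 0\<^sub>v n" by (rule zero[OF kk[OF elim] B'])
      then show ?case using x0 by simp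
    qed
    then have "((\<lambda>h. (\<xi> h $ a - x B $ a) / h) \<longlongrightarrow> 0) (at 0)"
      by (rule Lim_transform_eventually[OF tendsto_const])
    ultimately show ?thesis by (simp only:)
  next
    case q: False
    \<comment> \<open>These bounds, uniform in \<open>\<tau>\<close>, make the displacement of order
      \<open>\<tau>\<close>. This yields continuity at 0 before anything is known about the limit of
      \<open>Z\<close>.\<close>
    have bdx: "\<bar>\<xi> \<tau> $ j\<bar> \<le> sqrt (q \<bullet> q)" if "\<bar>\<tau>\<bar> < \<tau>0" for \<tau>
    proof -
      note kr = kkt_pair_rank_one[OF kk[OF that] B d v]
      have "(\<xi> \<tau> $ j)\<^sup>2 \<le> \<xi> \<tau> \<bullet> \<xi> \<tau>"
        unfolding scalar_prod_def power2_eq_square using kr(1) j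
        by (intro member_le_sum[of j _ "\<lambda>i. \<xi> \<tau> $ i * \<xi> \<tau> $ i"]) auto
      also have "\<dots> \<le> q \<bullet> q" by (rule kkt_pair_norm(2)[OF kk[OF that] B'])
      finally show ?thesis by (simp add: real_le_rsqrt)
    qed
    have bdz: "\<bar>Z \<tau> $ r\<bar> \<le> 1" if "\<bar>\<tau>\<bar> < \<tau>0" for \<tau>
      using kkt_pair_rank_one(5)[OF kk[OF that] B d v r] .
    have limx: "((\<lambda>\<tau>. \<xi> \<tau> $ i) \<longlongrightarrow> x B $ i) (at 0)" if i: "i < n" for i
    proof (rule LIM_zero_cancel)
      have "\<forall>\<^sub>F \<tau> in at 0. norm (\<xi> \<tau> $ i - x B $ i) \<le>
          norm \<tau> * (sqrt (q \<bullet> q) * \<bar>X $$ (i, r)\<bar> + \<bar>P $$ (i, j)\<bar>)"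
        using ev
      proof eventually_elim
        case (elim \<tau>)
        have "\<bar>\<xi> \<tau> $ j * X $$ (i, r) + Z \<tau> $ r * P $$ (i, j)\<bar> \<le>
            \<bar>\<xi> \<tau> $ j\<bar> * \<bar>X $$ (i, r)\<bar> + \<bar>Z \<tau> $ r\<bar> * \<bar>P $$ (i, j)\<bar>"
          by (metis abs_mult abs_triangle_ineq)
        also have "\<dots> \<le> sqrt (q \<bullet> q) * \<bar>X $$ (i, r)\<bar> + 1 * \<bar>P $$ (i, j)\<bar>"
          using bdx[OF elim] bdz[OF elim] by (intro add_mono mult_right_mono) auto
        finally show ?case
          using disp[OF elim i] by (simp add: abs_mult mult_left_mono)
      qed
      then show "((\<lambda>\<tau>. \<xi> \<tau> $ i - x B $ i) \<longlongrightarrow> 0) (at 0)"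
        by (rule tendsto_0_le[OF tendsto_ident_at])
    qed
    \<comment> \<open>The multiplier enters the quotient only through this product, so its own limit
      is sought only where \<open>P $$ (a, j)\<close> is nonzero.\<close>
    have limz: "((\<lambda>\<tau>. Z \<tau> $ r * P $$ (a, j)) \<longlongrightarrow> (u \<bullet> q) * P $$ (a, j)) (at 0)"
    proof (cases "P $$ (a, j) = 0")
      case False
      have Bu: "B *\<^sub>v u \<in> carrier_vec m" using B u by simp
      \<comment> \<open>The residual \<open>d - B *\<^sub>v u\<close> is in the left kernel of
        \<open>B\<close>, and \<open>P *\<^sub>v v\<close> is a nonzero kernel vector because its
        entry \<open>a\<close> is \<open>P $$ (a, j)\<close>. A nonzero residual would therefore
        force \<open>q = 0\<close>.\<close>
      have "d = B *\<^sub>v u"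
      proof (rule ccontr)
        assume ne: "d \<noteq> B *\<^sub>v u"
        have c: "d - B *\<^sub>v u \<noteq> 0\<^sub>v m"
        proof
          assume *: "d - B *\<^sub>v u = 0\<^sub>v m"
          have "d = B *\<^sub>v u"
          proof (rule eq_vecI)
            fix i assume "i < dim_vec (B *\<^sub>v u)"
            then have "i < m" using B by simp
            then show "d $ i = (B *\<^sub>v u) $ i"
              using arg_cong[OF *, of "\<lambda>w. w $ i"] d B by (simp del: index_mult_mat_vec)
          qed (use d B in simp)
          then show False using ne by simp
        qed
        have v': "P *\<^sub>v v \<in> carrier_vec n" "P *\<^sub>v v \<noteq> 0\<^sub>v n"
          using v pinv_carrier(4) Pv[OF a] a False by (simp, metis index_zero_vec(1))
        have c': "d - B *\<^sub>v u \<in> carrier_vec m" "transpose_mat B *\<^sub>v (d - B *\<^sub>v u) = 0\<^sub>v n"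
          using d Bu left_null_vec[OF d] by (simp_all add: u_def)
        have solv': "\<exists>x z. kkt_pair A q x z" if "A \<in> carrier_mat m n"
          "\<And>i j. i < m \<Longrightarrow> j < n \<Longrightarrow> \<bar>A $$ (i, j) - B $$ (i, j)\<bar> < e" for A
          using solv[OF that] by auto
        have "q = 0\<^sub>v n"
          by (rule kkt_pair_rank_alternative[OF B k0 e solv' c'(1) c c'(2) v' mult_null_projector_vec[OF v]])
        then show False using q by simp
      qed
      note dBu = this
      \<comment> \<open>Pairing stationarity with \<open>u\<close> and using
        \<open>B *\<^sub>v u = d\<close> isolates entry \<open>r\<close> of the multiplier. The left
        side tends to \<open>u \<bullet> q\<close>, since \<open>u\<close> is orthogonal to
        \<open>x B\<close>.\<close>
      have zr: "u \<bullet> q - u \<bullet> \<xi> \<tau> - \<tau> * Z \<tau> $ r * u $ j = Z \<tau> $ r" if "\<bar>\<tau>\<bar> < \<tau>0" for \<tau>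
      proof -
        note kr = kkt_pair_rank_one[OF kk[OF that] B d v]
        have Bt: "transpose_mat B *\<^sub>v Z \<tau> \<in> carrier_vec n" using B kr(2) by simp
        have "u \<bullet> q = u \<bullet> (\<xi> \<tau> + (transpose_mat B *\<^sub>v Z \<tau> + (\<tau> * (d \<bullet> Z \<tau>)) \<cdot>\<^sub>v v))"
          using kr(4) by simp
        also have "\<dots> = u \<bullet> \<xi> \<tau> + (u \<bullet> (transpose_mat B *\<^sub>v Z \<tau>) + \<tau> * (d \<bullet> Z \<tau>) * (u \<bullet> v))"
          using u v kr(1) Bt by (simp add: scalar_prod_add_distrib[of _ n])
        also have "u \<bullet> (transpose_mat B *\<^sub>v Z \<tau>) = Z \<tau> \<bullet> d"
          using comm_scalar_prod[OF u Bt] transpose_vec_mult_scalar[OF B u kr(2)] dBu by simp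
        also have "Z \<tau> \<bullet> d = Z \<tau> $ r" using comm_scalar_prod[OF kr(2) d] dotd[OF kr(2)] by simp
        also have "u \<bullet> v = u $ j" using comm_scalar_prod[OF u v] dot[OF u] by simp
        finally show ?thesis using dotd[OF kr(2)] by simp
      qed
      have "((\<lambda>\<tau>. u \<bullet> \<xi> \<tau>) \<longlongrightarrow> u \<bullet> x B) (at 0)"
      proof -
        have "((\<lambda>\<tau>. \<Sum>i\<in>{0..<n}. u $ i * \<xi> \<tau> $ i) \<longlongrightarrow> (\<Sum>i\<in>{0..<n}. u $ i * x B $ i)) (at 0)"
          by (intro tendsto_sum tendsto_mult tendsto_const limx) auto
        then have "((\<lambda>\<tau>. \<Sum>i\<in>{0..<n}. u $ i * \<xi> \<tau> $ i) \<longlongrightarrow> u \<bullet> x B) (at 0)"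
          using kd0(1) by (simp add: scalar_prod_def)
        moreover have "\<forall>\<^sub>F \<tau> in at 0. (\<Sum>i\<in>{0..<n}. u $ i * \<xi> \<tau> $ i) = u \<bullet> \<xi> \<tau>"
          using ev
        proof eventually_elim
          case (elim \<tau>)
          show ?case using kkt_pair_rank_one(1)[OF kk[OF elim] B d v] by (simp add: scalar_prod_def)
        qed
        ultimately show ?thesis by (rule Lim_transform_eventually)
      qed
      moreover have "u \<bullet> x B = 0" unfolding u_def by (rule pinv_range_orthogonal[OF d kd0(1,3)])
      moreover have "((\<lambda>\<tau>. \<tau> * Z \<tau> $ r * u $ j) \<longlongrightarrow> 0) (at 0)"
      proof (rule tendsto_0_le[OF tendsto_ident_at])
        show "\<forall>\<^sub>F \<tau> in at 0. norm (\<tau> * Z \<tau> $ r * u $ j) \<le> norm \<tau> * \<bar>u $ j\<bar>"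
          using ev
        proof eventually_elim
          case (elim \<tau>)
          have "\<bar>\<tau>\<bar> * \<bar>Z \<tau> $ r\<bar> * \<bar>u $ j\<bar> \<le> \<bar>\<tau>\<bar> * 1 * \<bar>u $ j\<bar>"
            using bdz[OF elim] by (intro mult_right_mono mult_left_mono) auto
          then show ?case by (simp add: abs_mult)
        qed
      qed
      ultimately have "((\<lambda>\<tau>. u \<bullet> q - u \<bullet> \<xi> \<tau> - \<tau> * Z \<tau> $ r * u $ j) \<longlongrightarrow> u \<bullet> q - 0 - 0) (at 0)"
        by (intro tendsto_diff tendsto_const) simp_all
      moreover have "\<forall>\<^sub>F \<tau> in at 0. u \<bullet> q - u \<bullet> \<xi> \<tau> - \<tau> * Z \<tau> $ r * u $ j = Z \<tau> $ r"
        using ev by eventually_elim (rule zr)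
      ultimately have "((\<lambda>\<tau>. Z \<tau> $ r) \<longlongrightarrow> u \<bullet> q - 0 - 0) (at 0)"
        by (rule Lim_transform_eventually)
      then show ?thesis by (intro tendsto_mult_right) simp
    qed simp
    have "((\<lambda>\<tau>. - (\<xi> \<tau> $ j * X $$ (a, r) + Z \<tau> $ r * P $$ (a, j))) \<longlongrightarrow> D) (at 0)"
      unfolding D_def by (intro tendsto_minus tendsto_add tendsto_mult_right limx j limz)
    moreover have "\<forall>\<^sub>F h in at 0. - (\<xi> h $ j * X $$ (a, r) + Z h $ r * P $$ (a, j)) = (\<xi> h $ a - x B $ a) / h"
      using ev eventually_neq_at_within[of 0]
    proof eventually_elim
      case (elim h)
      have "\<xi> h $ a - x B $ a = h * - (\<xi> h $ j * X $$ (a, r) + Z h $ r * P $$ (a, j))"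
        using disp[OF elim(1) a] by (simp add: algebra_simps)
      then show ?case using elim(2) by simp
    qed
    ultimately show ?thesis by (rule Lim_transform_eventually)
  qed
  have "((\<lambda>\<tau>. \<xi> \<tau> $ a) has_real_derivative D) (at 0)"
    unfolding DERIV_def using quot \<xi>0 by simp
  then show ?thesis by (simp only: \<xi>_def D_def u_def d_def v_def)
qed

end

section \<open>The gradients of the loss\<close>

text \<open>Constancy of the sign turns the rows in \<open>I\<close> into equality constraints and
  fixes the multipliers on \<open>J\<close> to \<open>s\<close>. What remains of the optimality
  conditions is a linear system with a bounded multiplier.\<close>

lemma nearby_minimizer_kkt_pair:
  fixes n k :: nat and y s :: "real vec" and W W0 Wpm :: "real mat"
  assumes y: "y \<in> carrier_vec n" and W: "W \<in> carrier_mat k n"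
    and sign_const: "open_mat_set k n S" "W \<in> S" "\<forall>W'\<in>S. sign_vec y W' = sign_vec y W"
    and I: "I = zero_indices (W *\<^sub>v minimizer y W)"
    and J: "J = nonzero_indices (W *\<^sub>v minimizer y W)"
    and W0: "W0 = select_rows W I" and Wpm: "Wpm = select_rows W J"
    and s: "s = nonzero_entries (sign_vec y W)"
  shows "\<exists>e>0. \<forall>B M. B \<in> carrier_mat (card I) n \<longrightarrow> M \<in> carrier_mat (card J) n \<longrightarrow>
    (\<forall>i<card I. \<forall>j<n. \<bar>B $$ (i, j) - W0 $$ (i, j)\<bar> < e) \<longrightarrow>
    (\<forall>i<card J. \<forall>j<n. \<bar>M $$ (i, j) - Wpm $$ (i, j)\<bar> < e) \<longrightarrow>
    (\<exists>z. kkt_pair B (y - transpose_mat M *\<^sub>v s) (minimizer y (merge_rows I B M)) z)"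
proof -
  define v where "v = W *\<^sub>v minimizer y W"
  have v: "v \<in> carrier_vec k" using W unfolding v_def by (intro carrier_vecI) simp
  have I': "I = zero_indices v" and J': "J = nonzero_indices v" by (simp_all add: I J v_def)
  note ctx = v I' J'
  note W0c = select_rows_carrier[OF ctx W disjI1[OF refl], folded W0]
    and Wpmc = select_rows_carrier[OF ctx W disjI2[OF refl], folded Wpm]
  have Wm: "merge_rows I W0 Wpm = W"
    using merge_select_rows[of v W] v W by (simp add: I' J' W0 Wpm)
  have sgn_v: "sign_vec y W = map_vec sgn v" by (simp add: sign_vec_def v_def)
  have s_eq: "s = vec (card J) (\<lambda>r. sgn (v $ pick J r))"
    unfolding s sgn_v by (rule nonzero_entries_sgn[OF ctx])
  \<comment> \<open>The entrywise radius around \<open>W\<close> serves for both blocks, as each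
    entry of the merged matrix is an entry of one of them.\<close>
  obtain e where e: "e > 0" and eS: "\<forall>A\<in>carrier_mat k n.
      (\<forall>i<k. \<forall>j<n. \<bar>A $$ (i, j) - W $$ (i, j)\<bar> < e) \<longrightarrow> A \<in> S"
    using sign_const(1,2) unfolding open_mat_set_def by blast
  have "\<exists>z. kkt_pair B (y - transpose_mat M *\<^sub>v s) (minimizer y (merge_rows I B M)) z"
    if B: "B \<in> carrier_mat (card I) n" and M: "M \<in> carrier_mat (card J) n"
      and cB: "\<forall>i<card I. \<forall>j<n. \<bar>B $$ (i, j) - W0 $$ (i, j)\<bar> < e"
      and cM: "\<forall>i<card J. \<forall>j<n. \<bar>M $$ (i, j) - Wpm $$ (i, j)\<bar> < e" for B M
  proof -
    let ?A = "merge_rows I B M"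
    have A: "?A \<in> carrier_mat k n" by (rule merge_rows_carrier[OF ctx B M])
    have "\<bar>?A $$ (i, j) - W $$ (i, j)\<bar> < e" if ij: "i < k" "j < n" for i j
    proof (cases "i \<in> I")
      case True
      have "card {a \<in> I. a < i} < card I"
        using True index_sets(1)[OF ctx] by (intro psubset_card_mono) auto
      then have "\<bar>?A $$ (i, j) - merge_rows I W0 Wpm $$ (i, j)\<bar> < e"
        using merge_rows_index(1)[OF ctx B M ij True] merge_rows_index(1)[OF ctx W0c Wpmc ij True]
          cB ij(2) by simp
      then show ?thesis unfolding Wm .
    next
      case False
      then have i: "i \<in> J" using index_sets(4)[OF ctx] ij(1) by auto
      have "card {a \<in> J. a < i} < card J"
        using i index_sets(2)[OF ctx] by (intro psubset_card_mono) auto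
      then have "\<bar>?A $$ (i, j) - merge_rows I W0 Wpm $$ (i, j)\<bar> < e"
        using merge_rows_index(2)[OF ctx B M ij i] merge_rows_index(2)[OF ctx W0c Wpmc ij i]
          cM ij(2) by simp
      then show ?thesis unfolding Wm .
    qed
    then have "?A \<in> S" using eS A by simp
    then have sgA: "sign_vec y ?A = map_vec sgn v" using sign_const(3) sgn_v by simp
    define x where "x = minimizer y ?A"
    obtain z where z: "x \<in> carrier_vec n" "z \<in> carrier_vec k" "y = x + transpose_mat ?A *\<^sub>v z"
      "\<And>i. i < k \<Longrightarrow> \<bar>z $ i\<bar> \<le> 1" "\<And>i. i < k \<Longrightarrow> z $ i * (?A *\<^sub>v x) $ i = \<bar>(?A *\<^sub>v x) $ i\<bar>"
      using minimizer_kkt[OF A y] unfolding x_def by blast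
    have Ax: "?A *\<^sub>v x \<in> carrier_vec k" using A z(1) by simp
    have sg: "sgn ((?A *\<^sub>v x) $ i) = sgn (v $ i)" if "i < k" for i
    proof -
      have "map_vec sgn (?A *\<^sub>v x) $ i = map_vec sgn v $ i"
        using sgA by (simp add: sign_vec_def x_def)
      then show ?thesis using that A v by (simp del: index_mult_mat_vec)
    qed
    note sel = select_merge_rows[OF ctx B M]
    have pI: "pick I r < k" "v $ pick I r = 0" if "r < card I" for r
      using pick_less(1)[OF ctx that] pick_in_set[of r I] that by (auto simp: I' zero_indices_def)
    have pJ: "pick J r < k" "v $ pick J r \<noteq> 0" if "r < card J" for r
      using pick_less(2)[OF ctx that] pick_in_set[of r J] that by (auto simp: J' nonzero_indices_def)
    have "(B *\<^sub>v x) $ r = 0" if r: "r < card I" for r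
    proof -
      have "(B *\<^sub>v x) $ r = (?A *\<^sub>v x) $ pick I r"
        using select_rows_mult_vec[OF ctx A disjI1[OF refl] r z(1)] sel(1) by simp
      then show ?thesis using sg[OF pI(1)[OF r]] pI(2)[OF r] by (simp add: sgn_eq_0_iff)
    qed
    then have Bx: "B *\<^sub>v x = 0\<^sub>v (card I)"
      using B by (intro eq_vecI) (simp_all del: index_mult_mat_vec)
    \<comment> \<open>Where the product is nonzero, complementarity determines the multiplier as its
      sign, and this sign is the one at \<open>W\<close>.\<close>
    have "z $ pick J r = sgn (v $ pick J r)" if r: "r < card J" for r
    proof -
      have "(?A *\<^sub>v x) $ pick J r \<noteq> 0"
        using sg[OF pJ(1)[OF r]] pJ(2)[OF r] by (metis sgn_eq_0_iff)
      then have "z $ pick J r = sgn ((?A *\<^sub>v x) $ pick J r)"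
        using z(5)[OF pJ(1)[OF r]]
        by (simp add: abs_sgn mult.commute)
      then show ?thesis using sg[OF pJ(1)[OF r]] by simp
    qed
    then have zs: "vec (card J) (\<lambda>r. z $ pick J r) = s" unfolding s_eq by (intro eq_vecI) auto
    define z0 where "z0 = vec (card I) (\<lambda>r. z $ pick I r)"
    have z0: "z0 \<in> carrier_vec (card I)" by (simp add: z0_def)
    have sc: "s \<in> carrier_vec (card J)" by (simp add: s_eq)
    have "transpose_mat ?A *\<^sub>v z = transpose_mat B *\<^sub>v z0 + transpose_mat M *\<^sub>v s"
      using transpose_mult_vec_split[OF ctx A z(2)] unfolding sel zs z0_def .
    then have "y - transpose_mat M *\<^sub>v s = x + transpose_mat B *\<^sub>v z0"
      using z(1,3) z0 sc B M by (intro eq_vecI) (auto simp del: index_mult_mat_vec)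
    moreover have "\<bar>z0 $ r\<bar> \<le> 1" if "r < card I" for r
      using z(4)[OF pI(1)[OF that]] that by (simp add: z0_def)
    ultimately have "kkt_pair B (y - transpose_mat M *\<^sub>v s) x z0"
      using B z(1) z0 Bx by (simp add: kkt_pair_def)
    then show ?thesis unfolding x_def by blast
  qed
  then show ?thesis using e by blast
qed

section \<open>Partial derivatives as rank one perturbations, and entries of the claimed
  gradients\<close>

lemma update_entry_eq:
  assumes "A \<in> carrier_mat m n" "i < m" "j < n"
  shows "update_entry A (i, j) t =
    A + (t - A $$ (i, j)) \<cdot>\<^sub>m outer_prod (unit_vec m i) (unit_vec n j)"
  using assms by (intro eq_matI) (auto simp: update_entry_def outer_prod_def)

text \<open>Chain rule with a shift: \<open>t0\<close> will be the current matrix entry, so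
  \<open>f\<close> is parametrised by the increment and differentiated at 0.\<close>

lemma half_square_has_derivative:
  fixes f :: "real \<Rightarrow> real vec"
  assumes "\<And>a. a < n \<Longrightarrow> ((\<lambda>\<tau>. f \<tau> $ a) has_real_derivative D a) (at 0)"
    and c: "c \<in> carrier_vec n"
  shows "((\<lambda>t. 1/2 * (l2_norm (f (t - t0) - c))\<^sup>2) has_real_derivative
    (\<Sum>a<n. (f 0 - c) $ a * D a)) (at t0)"
proof -
  have eq: "1/2 * (l2_norm (f \<tau> - c))\<^sup>2 = (\<Sum>a<n. 1/2 * (f \<tau> $ a - c $ a)\<^sup>2)" for \<tau>
    using c unfolding l2_norm_square
    by (simp add: scalar_prod_def atLeast0LessThan power2_eq_square sum_divide_distrib)
  have "((\<lambda>\<tau>. \<Sum>a<n. 1/2 * (f \<tau> $ a - c $ a)\<^sup>2) has_real_derivative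
      (\<Sum>a<n. (f 0 $ a - c $ a) * D a)) (at 0)"
    using assms(1) by (intro DERIV_sum) (auto intro!: derivative_eq_intros)
  then have "((\<lambda>\<tau>. 1/2 * (l2_norm (f \<tau> - c))\<^sup>2) has_real_derivative
      (\<Sum>a<n. (f 0 - c) $ a * D a)) (at (t0 + - t0))"
    unfolding eq using c by simp
  from this[unfolded DERIV_shift] show ?thesis by simp
qed

text \<open>Matches the stated gradient with the inner product of \<open>g\<close> and the
  derivative of the minimizer. Symmetry of \<open>P\<close> exchanges its row \<open>j\<close> for
  the column \<open>j\<close> occurring in that derivative.\<close>

lemma kernel_rows_gradient_entry:
  fixes P X :: "real mat"
  assumes P: "P \<in> carrier_mat n n" "transpose_mat P = P" and X: "X \<in> carrier_mat n m"
    and q: "q \<in> carrier_vec n" and g: "g \<in> carrier_vec n" and r: "r < m" and j: "j < n"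
  shows "(- transpose_mat (P * (outer_prod q g + outer_prod g q) * X)) $$ (r, j) =
    (\<Sum>a<n. g $ a * - ((P *\<^sub>v q) $ j * X $$ (a, r) + ((X *\<^sub>v unit_vec m r) \<bullet> q) * P $$ (a, j)))"
proof -
  let ?O = "outer_prod q g + outer_prod g q"
  have O: "?O \<in> carrier_mat n n" using q g by simp
  have sym: "P $$ (a, b) = P $$ (b, a)" if "a < n" "b < n" for a b
    using P that by (metis carrier_matD index_transpose_mat(1))
  have Pw: "(P *\<^sub>v w) $ j = (\<Sum>b<n. P $$ (j, b) * w $ b)" if "w \<in> carrier_vec n" for w
    using that P(1) j by (simp add: scalar_prod_def atLeast0LessThan)
  have Pg: "(P *\<^sub>v g) $ j = (\<Sum>a<n. g $ a * P $$ (a, j))"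
    unfolding Pw[OF g] using sym[OF j] by (intro sum.cong) auto
  have PO: "(P * ?O) $$ (j, a) = (P *\<^sub>v q) $ j * g $ a + (P *\<^sub>v g) $ j * q $ a" if a: "a < n" for a
  proof -
    have "(P * ?O) $$ (j, a) = (\<Sum>b<n. P $$ (j, b) * (q $ b * g $ a + g $ b * q $ a))"
      using P(1) q g j a
      by (simp add: scalar_prod_def atLeast0LessThan outer_prod_index[OF q g] outer_prod_index[OF g q])
    also have "\<dots> = (\<Sum>b<n. P $$ (j, b) * q $ b) * g $ a + (\<Sum>b<n. P $$ (j, b) * g $ b) * q $ a"
      by (simp add: sum.distrib sum_distrib_left sum_distrib_right algebra_simps)
    finally show ?thesis unfolding Pw[OF q] Pw[OF g] .
  qed
  have Xr: "(X *\<^sub>v unit_vec m r) \<bullet> q = (\<Sum>a<n. q $ a * X $$ (a, r))"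
    using X q r by (simp add: scalar_prod_def[of _ q] atLeast0LessThan mult.commute)
  have POc: "P * ?O \<in> carrier_mat n n" using P(1) O by simp
  have "(P * ?O * X) $$ (j, r) = row (P * ?O) j \<bullet> col X r"
    using P(1) POc X j r by (intro index_mult_mat(1)) simp_all
  also have "\<dots> = (\<Sum>a<n. (P * ?O) $$ (j, a) * X $$ (a, r))"
    using P(1) POc X j r unfolding scalar_prod_def
    by (auto simp: atLeast0LessThan simp del: index_mult_mat(1) intro!: sum.cong)
  also have "\<dots> = (\<Sum>a<n. ((P *\<^sub>v q) $ j * g $ a + (P *\<^sub>v g) $ j * q $ a) * X $$ (a, r))"
    using PO by (intro sum.cong) auto
  also have "\<dots> = (P *\<^sub>v q) $ j * (\<Sum>a<n. g $ a * X $$ (a, r)) +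
      (P *\<^sub>v g) $ j * (\<Sum>a<n. q $ a * X $$ (a, r))"
    by (simp add: distrib_right sum.distrib sum_distrib_left mult.assoc)
  also have "\<dots> = (P *\<^sub>v q) $ j * (\<Sum>a<n. g $ a * X $$ (a, r)) +
      (\<Sum>a<n. g $ a * P $$ (a, j)) * ((X *\<^sub>v unit_vec m r) \<bullet> q)"
    unfolding Pg Xr ..
  also have "\<dots> = (\<Sum>a<n. g $ a *
      ((P *\<^sub>v q) $ j * X $$ (a, r) + ((X *\<^sub>v unit_vec m r) \<bullet> q) * P $$ (a, j)))"
    by (simp add: distrib_left sum.distrib sum_distrib_left sum_distrib_right mult_ac)
  finally have entry: "(P * ?O * X) $$ (j, r) = \<dots>" .
  have "(- transpose_mat M) $$ (r, j) = - M $$ (j, r)" if "M \<in> carrier_mat n m" for M :: "real mat"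
    using that r j by simp
  from this[OF mult_carrier_mat[OF POc X]] show ?thesis
    unfolding entry by (simp only: mult_minus_right sum_negf)
qed

lemma nonzero_rows_gradient_entry:
  fixes P :: "real mat"
  assumes P: "P \<in> carrier_mat n n" and s: "s \<in> carrier_vec m" and g: "g \<in> carrier_vec n"
    and r: "r < m" and j: "j < n"
  shows "(- (outer_prod s g * P)) $$ (r, j) = (\<Sum>a<n. g $ a * - (s $ r * P $$ (a, j)))"
proof -
  have "(outer_prod s g * P) $$ (r, j) = (\<Sum>a<n. g $ a * (s $ r * P $$ (a, j)))"
    using P s g r j
    by (simp add: scalar_prod_def atLeast0LessThan outer_prod_index[OF s g] mult_ac)
  then show ?thesis using P s g r j by (simp add: sum_negf del: index_mult_mat(1))
qed

theorem lemma1: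
  fixes n k :: nat
    and x\<^sub>t y\<^sub>t q g s :: "real vec"
    and W W0 Wpm P :: "real mat"
    and I0 Ipm :: "nat set"
  assumes "x\<^sub>t \<in> carrier_vec n" and "y\<^sub>t \<in> carrier_vec n" and "W \<in> carrier_mat k n"
    and sign_const:
      "\<exists>S. open_mat_set k n S \<and> W \<in> S \<and> (\<forall>W'\<in>S. sign_vec y\<^sub>t W' = sign_vec y\<^sub>t W)"
    and I0: "I0 = zero_indices (W *\<^sub>v minimizer y\<^sub>t W)"
    and Ipm: "Ipm = nonzero_indices (W *\<^sub>v minimizer y\<^sub>t W)"
    and W0: "W0 = select_rows W I0"
    and Wpm: "Wpm = select_rows W Ipm"
    and s: "s = nonzero_entries (sign_vec y\<^sub>t W)"
    and P: "P = null_projector W0"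
    and q: "q = y\<^sub>t - transpose_mat Wpm *\<^sub>v s"
    and g: "g = minimizer y\<^sub>t W - x\<^sub>t"
  shows "has_mat_gradient (\<lambda>M. loss x\<^sub>t y\<^sub>t (merge_rows I0 W0 M))
           (- (outer_prod s g * P)) Wpm
       \<and> has_mat_gradient (\<lambda>M. loss x\<^sub>t y\<^sub>t (merge_rows I0 M Wpm))
           (- transpose_mat (P * (outer_prod q g + outer_prod g q) * pseudo_inverse W0)) W0"
proof -
  note xt = assms(1) and yt = assms(2) and W = assms(3)
  define X where "X = pseudo_inverse W0"
  define m0 m1 where "m0 = card I0" and "m1 = card Ipm"
  have v: "W *\<^sub>v minimizer y\<^sub>t W \<in> carrier_vec k" using W by (intro carrier_vecI) simp
  note ctx = v I0 Ipm
  have W0c: "W0 \<in> carrier_mat m0 n" and Wpmc: "Wpm \<in> carrier_mat m1 n"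
    unfolding W0 Wpm m0_def m1_def by (intro select_rows_carrier[OF ctx W]; simp)+
  have Wm: "merge_rows I0 W0 Wpm = W"
    using merge_select_rows[of _ W] v W by (simp add: I0 Ipm W0 Wpm)
  have sc: "s \<in> carrier_vec m1"
    using nonzero_entries_sgn[OF ctx] by (simp add: s m1_def sign_vec_def)
  have qc: "q \<in> carrier_vec n" using yt Wpmc sc by (simp add: q)
  have "minimizer y\<^sub>t W \<in> carrier_vec n" using minimizer_kkt[OF W yt] by blast
  then have gc: "g \<in> carrier_vec n" using xt by (simp add: g)
  have pinv: "is_pseudo_inverse W0 X" unfolding X_def by (rule pseudo_inverse)
  have PX: "P = 1\<^sub>m n - X * W0" using W0c by (simp add: P null_projector_def X_def)
  note pc = pinv_carrier[OF W0c pinv PX] and Psym = transpose_null_projector[OF W0c pinv PX]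
  obtain S where S: "open_mat_set k n S" "W \<in> S" "\<forall>W'\<in>S. sign_vec y\<^sub>t W' = sign_vec y\<^sub>t W"
    using sign_const by (elim exE conjE) (rule that)
  obtain e where e: "e > 0" and near: "\<forall>B M. B \<in> carrier_mat m0 n \<longrightarrow> M \<in> carrier_mat m1 n \<longrightarrow>
    (\<forall>i<m0. \<forall>j<n. \<bar>B $$ (i, j) - W0 $$ (i, j)\<bar> < e) \<longrightarrow>
    (\<forall>i<m1. \<forall>j<n. \<bar>M $$ (i, j) - Wpm $$ (i, j)\<bar> < e) \<longrightarrow>
    (\<exists>z. kkt_pair B (y\<^sub>t - transpose_mat M *\<^sub>v s) (minimizer y\<^sub>t (merge_rows I0 B M)) z)"
    using nearby_minimizer_kkt_pair[OF yt W S I0 Ipm W0 Wpm s, folded m0_def m1_def]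
    by (elim exE conjE) (rule that)
  \<comment> \<open>The blocks are moved one at a time. With \<open>Wpm\<close> fixed,
    \<open>q\<close> is constant and only the constraint matrix varies.\<close>
  have near0: "\<exists>z. kkt_pair B q (minimizer y\<^sub>t (merge_rows I0 B Wpm)) z"
    if "B \<in> carrier_mat m0 n" "\<And>i j. i < m0 \<Longrightarrow> j < n \<Longrightarrow> \<bar>B $$ (i, j) - W0 $$ (i, j)\<bar> < e" for B
    using near[THEN spec, THEN spec, of B Wpm] that Wpmc e by (simp add: q)
  \<comment> \<open>With \<open>W0\<close> fixed, the projector is constant, which makes the
    minimizer an explicit affine function of \<open>M\<close>.\<close>
  have near1: "minimizer y\<^sub>t (merge_rows I0 W0 M) = P *\<^sub>v (y\<^sub>t - transpose_mat M *\<^sub>v s)"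
    if M: "M \<in> carrier_mat m1 n" and c: "\<And>i j. i < m1 \<Longrightarrow> j < n \<Longrightarrow> \<bar>M $$ (i, j) - Wpm $$ (i, j)\<bar> < e" for M
  proof -
    have "\<exists>z. kkt_pair W0 (y\<^sub>t - transpose_mat M *\<^sub>v s) (minimizer y\<^sub>t (merge_rows I0 W0 M)) z"
      using near[THEN spec, THEN spec, of W0 M] M c W0c e by simp
    then show ?thesis using kkt_pair_null_projector[OF W0c pinv PX] by auto
  qed
  have x0: "minimizer y\<^sub>t W = P *\<^sub>v q"
    using near1[OF Wpmc] e by (simp add: Wm q)

  have "((\<lambda>t. loss x\<^sub>t y\<^sub>t (merge_rows I0 (update_entry W0 (r, j) t) Wpm)) has_real_derivative
      (- transpose_mat (P * (outer_prod q g + outer_prod g q) * X)) $$ (r, j)) (at (W0 $$ (r, j)))"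
    if r: "r < m0" and j: "j < n" for r j
  proof -
    let ?E = "outer_prod (unit_vec m0 r) (unit_vec n j) :: real mat"
    define f where "f \<tau> = minimizer y\<^sub>t (merge_rows I0 (W0 + \<tau> \<cdot>\<^sub>m ?E) Wpm)" for \<tau>
    have "W0 + 0 \<cdot>\<^sub>m ?E = W0" using W0c by (intro eq_matI) auto
    then have f0: "f 0 - x\<^sub>t = g" by (simp add: f_def Wm g)
    define D where "D a = - ((P *\<^sub>v q) $ j * X $$ (a, r) + ((X *\<^sub>v unit_vec m0 r) \<bullet> q) * P $$ (a, j))" for a
    have D: "((\<lambda>\<tau>. f \<tau> $ a) has_real_derivative D a) (at 0)" if "a < n" for a
      using kkt_solution_has_derivative[OF W0c pinv PX e near0 r j that]
      unfolding f_def D_def Wm x0 .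
    have "((\<lambda>t. 1/2 * (l2_norm (f (t - W0 $$ (r, j)) - x\<^sub>t))\<^sup>2) has_real_derivative
        (\<Sum>a<n. (f 0 - x\<^sub>t) $ a * D a)) (at (W0 $$ (r, j)))"
      by (rule half_square_has_derivative[OF _ xt]) (rule D)
    then show ?thesis
      unfolding f0 D_def kernel_rows_gradient_entry[OF pc(4) Psym pc(1) qc gc r j, symmetric]
      unfolding loss_def update_entry_eq[OF W0c r j] f_def .
  qed
  moreover have "((\<lambda>t. loss x\<^sub>t y\<^sub>t (merge_rows I0 W0 (update_entry Wpm (r, j) t))) has_real_derivative
      (- (outer_prod s g * P)) $$ (r, j)) (at (Wpm $$ (r, j)))"
    if r: "r < m1" and j: "j < n" for r j
  proof -
    let ?d = "unit_vec m1 r :: real vec" and ?v = "unit_vec n j :: real vec"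
    define f where "f \<tau> = minimizer y\<^sub>t (merge_rows I0 W0 (Wpm + \<tau> \<cdot>\<^sub>m outer_prod ?d ?v))" for \<tau>
    have "Wpm + 0 \<cdot>\<^sub>m outer_prod ?d ?v = Wpm" using Wpmc by (intro eq_matI) auto
    then have f0: "f 0 - x\<^sub>t = g" by (simp add: f_def Wm g)
    have d: "?d \<in> carrier_vec m1" and v: "?v \<in> carrier_vec n" by simp_all
    obtain \<tau>0 where \<tau>0: "\<tau>0 > 0" and close: "\<forall>\<tau> i j. \<bar>\<tau>\<bar> < \<tau>0 \<longrightarrow> i < m1 \<longrightarrow> j < n \<longrightarrow>
        \<bar>(Wpm + \<tau> \<cdot>\<^sub>m outer_prod ?d ?v) $$ (i, j) - Wpm $$ (i, j)\<bar> < e"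
      using rank_one_update_close[OF Wpmc d v e] by (elim exE conjE) (rule that)
    \<comment> \<open>Changing entry \<open>(r, j)\<close> of \<open>Wpm\<close> by
      \<open>\<tau>\<close> lowers entry \<open>j\<close> of \<open>q\<close> by
      \<open>\<tau> * s $ r\<close>; applying \<open>P\<close> gives an exact formula, not just a
      first order one.\<close>
    have f_eq: "f \<tau> $ a = (P *\<^sub>v q) $ a - \<tau> * (s $ r * P $$ (a, j))"
      if \<tau>: "\<bar>\<tau>\<bar> < \<tau>0" and a: "a < n" for \<tau> a
    proof -
      let ?M = "Wpm + \<tau> \<cdot>\<^sub>m outer_prod ?d ?v"
      have M: "?M \<in> carrier_mat m1 n" using Wpmc by simp
      have "transpose_mat ?M *\<^sub>v s = transpose_mat Wpm *\<^sub>v s + (\<tau> * s $ r) \<cdot>\<^sub>v ?v"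
        using transpose_rank_one_update[OF Wpmc d v]
          rank_one_update_mult_vec[of "transpose_mat Wpm" n m1 ?v ?d s] Wpmc sc r by simp
      then have "y\<^sub>t - transpose_mat ?M *\<^sub>v s = q - (\<tau> * s $ r) \<cdot>\<^sub>v ?v"
        unfolding q using yt Wpmc sc by (intro eq_vecI) (auto simp del: index_mult_mat_vec)
      then have "f \<tau> = P *\<^sub>v (q - (\<tau> * s $ r) \<cdot>\<^sub>v ?v)"
        using near1[OF M] close[THEN spec, of \<tau>] \<tau> by (simp add: f_def)
      also have "\<dots> = P *\<^sub>v q - (\<tau> * s $ r) \<cdot>\<^sub>v (P *\<^sub>v ?v)"
        using pc(4) qc by (simp add: mult_minus_distrib_mat_vec[of _ n n] mult_mat_vec[of _ n n])
      finally have "f \<tau> = P *\<^sub>v q - (\<tau> * s $ r) \<cdot>\<^sub>v (P *\<^sub>v ?v)" .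
      moreover have "(P *\<^sub>v ?v) $ a = P $$ (a, j)" using pc(4) a j by simp
      ultimately show ?thesis using pc(4) a by (simp del: index_mult_mat_vec)
    qed
    have D: "((\<lambda>\<tau>. f \<tau> $ a) has_real_derivative - (s $ r * P $$ (a, j))) (at 0)" if a: "a < n" for a
    proof -
      have "((\<lambda>\<tau>. (P *\<^sub>v q) $ a - \<tau> * (s $ r * P $$ (a, j))) has_real_derivative
          - (s $ r * P $$ (a, j))) (at 0)"
        by (auto intro!: derivative_eq_intros)
      then show ?thesis
        by (rule has_field_derivative_transform_within[OF _ \<tau>0 UNIV_I])
          (simp add: f_eq[OF _ a] dist_real_def)
    qed
    have "((\<lambda>t. 1/2 * (l2_norm (f (t - Wpm $$ (r, j)) - x\<^sub>t))\<^sup>2) has_real_derivative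
        (\<Sum>a<n. (f 0 - x\<^sub>t) $ a * - (s $ r * P $$ (a, j)))) (at (Wpm $$ (r, j)))"
      by (rule half_square_has_derivative[OF _ xt]) (rule D)
    then show ?thesis
      unfolding f0 nonzero_rows_gradient_entry[OF pc(4) sc gc r j, symmetric]
      unfolding loss_def update_entry_eq[OF Wpmc r j] f_def .
  qed
  moreover have "- (outer_prod s g * P) \<in> carrier_mat m1 n" 
    using sc gc pc(4) by (intro carrier_matI) simp_all
  moreover have "- transpose_mat (P * (outer_prod q g + outer_prod g q) * X) \<in> carrier_mat m0 n"
    using qc gc pc by (intro carrier_matI) simp_all
  ultimately show ?thesis
    using W0c Wpmc unfolding has_mat_gradient_def X_def[symmetric] by auto
qed

end
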